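(* For every positive real number $\varepsilon$ there exists a solvable profinite group $G$ which contains an element $g$ such that $\mu(\mathcal N_G(g))>1-\varepsilon$, $g$ has infinite order modulo $Z_\infty(G)$, and there is no open subgroup $H$ of $G$ with $g\in Z_\infty(H)$.
   Context: For a profinite group $G$, $\mu$ is the normalized Haar measure of $G$, and $\langle X\rangle$ denotes the closed subgroup generated by $X\subseteq G$. For $x\in G$, $\mathcal N_G(x)=\{y\in G : \langle x,y\rangle \text{ is pronilpotent}\}$ (a closed subset of $G$). For a finite group, $Z_\infty$ denotes the hypercenter (last term of the upper central series). For a profinite group $G$, the hypercenter $Z_\infty(G)$ is the set of all $x\in G$ such that $xN\in Z_\infty(G/N)$ for every open normal subgroup $N$ of $G$. *)

theory Defs
  imports "HOL-Analysis.Analysis" "HOL-Algebra.Solvable_Groups"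
begin

section \<open>Nilpotency and the hypercenter of abstract groups\<close>

text \<open>The step says that the image of \<open>x\<close> is central in the quotient by the previous term,
  expressed through commutators.\<close>

primrec upper_central :: "('a, 'b) monoid_scheme \<Rightarrow> nat \<Rightarrow> 'a set" where
  "upper_central G 0 = {\<one>\<^bsub>G\<^esub>}"
| "upper_central G (Suc n) =
    {x \<in> carrier G. \<forall>y \<in> carrier G.
       x \<otimes>\<^bsub>G\<^esub> y \<otimes>\<^bsub>G\<^esub> inv\<^bsub>G\<^esub> x \<otimes>\<^bsub>G\<^esub> inv\<^bsub>G\<^esub> y \<in> upper_central G n}"

definition nilpotent_group :: "('a, 'b) monoid_scheme \<Rightarrow> bool" where
  "nilpotent_group G \<longleftrightarrow> group G \<and> (\<exists>n. upper_central G n = carrier G)"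

text \<open>The series is increasing and hence stationary in a finite group, where its last term is
  therefore the union. This definition is meant for finite groups only.\<close>

definition finite_hypercenter :: "('a, 'b) monoid_scheme \<Rightarrow> 'a set" where
  "finite_hypercenter G = (\<Union>n. upper_central G n)"

section \<open>Profinite groups\<close>

locale profinite_group = group G for G :: "('a, 'b) monoid_scheme" (structure) +
  fixes T :: "'a topology"
  assumes topspace_eq: "topspace T = carrier G"
    and continuous_mult: "continuous_map (prod_topology T T) T (\<lambda>(x, y). x \<otimes> y)"
    and continuous_inv: "continuous_map T T (\<lambda>x. inv x)"
    and compact: "compact_space T"
    and Hausdorff: "Hausdorff_space T"
    and totally_disconnected: "\<And>S. connectedin T S \<Longrightarrow> \<exists>a. S \<subseteq> {a}"

definition open_normal :: "('a, 'b) monoid_scheme \<Rightarrow> 'a topology \<Rightarrow> 'a set \<Rightarrow> bool" where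
  "open_normal G T N \<longleftrightarrow> N \<lhd> G \<and> openin T N"

definition pronilpotent_group :: "('a, 'b) monoid_scheme \<Rightarrow> 'a topology \<Rightarrow> bool" where
  "pronilpotent_group G T \<longleftrightarrow>
     profinite_group G T \<and> (\<forall>N. open_normal G T N \<longrightarrow> nilpotent_group (G Mod N))"

definition hypercenter :: "('a, 'b) monoid_scheme \<Rightarrow> 'a topology \<Rightarrow> 'a set" where
  "hypercenter G T =
     {x \<in> carrier G. \<forall>N. open_normal G T N \<longrightarrow> N #>\<^bsub>G\<^esub> x \<in> finite_hypercenter (G Mod N)}"

definition closed_generate :: "('a, 'b) monoid_scheme \<Rightarrow> 'a topology \<Rightarrow> 'a set \<Rightarrow> 'a set" where
  "closed_generate G T X = \<Inter>{H. subgroup H G \<and> closedin T H \<and> X \<subseteq> H}"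

definition pronilpotentizer :: "('a, 'b) monoid_scheme \<Rightarrow> 'a topology \<Rightarrow> 'a \<Rightarrow> 'a set" where
  "pronilpotentizer G T x =
     {y \<in> carrier G.
        pronilpotent_group (G \<lparr>carrier := closed_generate G T {x, y}\<rparr>)
          (subtopology T (closed_generate G T {x, y}))}"

text \<open>The left-invariant regular Borel probability measure. Outer regularity need not be
  stated: for a finite measure on a compact Hausdorff space it follows from inner regularity
  by complementation.\<close>

definition normalized_haar_measure ::
    "('a, 'b) monoid_scheme \<Rightarrow> 'a topology \<Rightarrow> 'a measure \<Rightarrow> bool" where
  "normalized_haar_measure G T \<mu> \<longleftrightarrow>
     sets \<mu> = sigma_sets (topspace T) {U. openin T U} \<and>
     emeasure \<mu> (carrier G) = 1 \<and>
     (\<forall>x \<in> carrier G. \<forall>A \<in> sets \<mu>. emeasure \<mu> (x <#\<^bsub>G\<^esub> A) = emeasure \<mu> A) \<and>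
     (\<forall>A \<in> sets \<mu>. emeasure \<mu> A = (SUP K \<in> {K. compactin T K \<and> K \<subseteq> A}. emeasure \<mu> K))"

end

theory Submission
  imports Defs "HOL-Probability.Infinite_Product_Measure" "HOL-Probability.Probability_Mass_Function"
    "HOL-Algebra.Product_Groups" "HOL-Algebra.Weak_Morphisms"
begin

text \<open>The group is a product of finite groups \<open>\<Gamma> i\<close> with the product topology, and \<open>g = (\<gamma> i)\<close>.
A closed subgroup of the product is pronilpotent as soon as all its projections are nilpotent, so
the pronilpotentizer of \<open>g\<close> is the box of those \<open>y\<close> for which every \<open>\<gamma> i\<close>
and \<open>y i\<close> generate a nilpotent group (\<open>pronilpotentizer_eq\<close>). If in the \<open>i\<close>-th factor the
exceptional elements form a proportion at most \<open>d i\<close>, the box has measure at least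
\<open>1 - (\<Sum>i. d i)\<close> (\<open>measure_haar_box\<close>). An open subgroup contains almost all factors; hence if
some power of \<open>g\<close> is hypercentral in an open subgroup, the same power of \<open>\<gamma> i\<close> is hypercentral in
\<open>\<Gamma> i\<close> for all large \<open>i\<close> (\<open>hypercenter_open_subgroup\<close>). Applied to the whole group this also
governs the order of \<open>g\<close> modulo the hypercenter.

So the problem is finite: find solvable groups of bounded derived length with an element \<open>\<gamma>\<close> of
large order modulo the hypercenter which generates a nilpotent group together with nearly every
element (\<open>exists_finite_factor\<close>). For an odd prime \<open>p\<close> let the group consist of the affine maps
\<open>w \<mapsto> v + M w\<close> on the space of functions \<open>\<int>/p \<rightarrow> \<int>/p\<close>, where \<open>M w x = f x * w (x + c)\<close> is a cyclic shift by \<open>c\<close> followed by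
signs \<open>f\<close> with product 1, and let \<open>\<gamma>\<close> be the translation by the constant vector 1. If \<open>c \<noteq> 0\<close>, then
\<open>c\<close> generates \<open>\<int>/p\<close>, so \<open>M ^ p\<close> multiplies by the product of all signs, which is 1; hence
\<open>(M - 1) ^ p = M ^ p - 1 = 0\<close> modulo \<open>p\<close>, and the group generated by all translations and by \<open>M\<close> is
nilpotent. Thus only elements with \<open>c = 0\<close>, a proportion of \<open>1 / p\<close>, can be exceptional. On the other hand
a sign change at the coordinate 0 acts on that coordinate as \<open>-1\<close>, so taking commutators of a
translation with it doubles the coordinate at each step and never ends at the identity: no
\<open>\<gamma> ^ n\<close> with \<open>0 < n < p\<close> is hypercentral.\<close>

section \<open>Nilpotency and hypercentrality through iterated commutators\<close>

definition commutator :: "('a, 'b) monoid_scheme \<Rightarrow> 'a \<Rightarrow> 'a \<Rightarrow> 'a" where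
  "commutator G x y = x \<otimes>\<^bsub>G\<^esub> y \<otimes>\<^bsub>G\<^esub> inv\<^bsub>G\<^esub> x \<otimes>\<^bsub>G\<^esub> inv\<^bsub>G\<^esub> y"

abbreviation iterated_commutator :: "('a, 'b) monoid_scheme \<Rightarrow> 'a \<Rightarrow> 'a list \<Rightarrow> 'a" where
  "iterated_commutator G \<equiv> foldl (commutator G)"

lemma (in group) commutator_closed [simp]:
  "x \<in> carrier G \<Longrightarrow> y \<in> carrier G \<Longrightarrow> commutator G x y \<in> carrier G"
  by (simp add: commutator_def)

lemma (in group) commutator_one_left [simp]:
  "y \<in> carrier G \<Longrightarrow> commutator G \<one> y = \<one>"
  by (simp add: commutator_def)

lemma (in group) iterated_commutator_closed:
  "x \<in> carrier G \<Longrightarrow> ys \<in> lists (carrier G) \<Longrightarrow> iterated_commutator G x ys \<in> carrier G"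
  by (induction ys arbitrary: x) auto

lemma (in group) iterated_commutator_one:
  "ys \<in> lists (carrier G) \<Longrightarrow> iterated_commutator G \<one> ys = \<one>"
  by (induction ys) auto

lemma (in group_hom) hom_commutator:
  "x \<in> carrier G \<Longrightarrow> y \<in> carrier G \<Longrightarrow> h (commutator G x y) = commutator H (h x) (h y)"
  by (simp add: commutator_def)

lemma (in group_hom) hom_iterated_commutator:
  "x \<in> carrier G \<Longrightarrow> ys \<in> lists (carrier G) \<Longrightarrow>
     h (iterated_commutator G x ys) = iterated_commutator H (h x) (map h ys)"
  by (induction ys arbitrary: x) (auto simp: hom_commutator)

lemma (in group) commutator_subgroup:
  "subgroup H G \<Longrightarrow> x \<in> H \<Longrightarrow> y \<in> H \<Longrightarrow> commutator (G\<lparr>carrier := H\<rparr>) x y = commutator G x y"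
  by (simp add: commutator_def m_inv_consistent)

lemma (in group) commutator_in_subgroup:
  "subgroup H G \<Longrightarrow> x \<in> H \<Longrightarrow> y \<in> H \<Longrightarrow> commutator G x y \<in> H"
  by (simp add: commutator_def subgroup.m_closed subgroup.m_inv_closed)

lemma (in group) iterated_commutator_subgroup:
  "subgroup H G \<Longrightarrow> x \<in> H \<Longrightarrow> ys \<in> lists H \<Longrightarrow>
     iterated_commutator (G\<lparr>carrier := H\<rparr>) x ys = iterated_commutator G x ys"
  by (induction ys arbitrary: x) (auto simp: commutator_subgroup commutator_in_subgroup)

text \<open>Unfolding the recursion of the upper central series gives a condition that only mentions left-normed
commutators. In this form nilpotency and hypercentrality pass to subgroups, quotients and coordinates
of a product by applying homomorphisms to commutators.\<close>

lemma (in group) upper_central_iff: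
  "x \<in> upper_central G n \<longleftrightarrow>
     x \<in> carrier G \<and> (\<forall>ys \<in> lists (carrier G). length ys = n \<longrightarrow> iterated_commutator G x ys = \<one>)"
proof (induction n arbitrary: x)
  case 0
  then show ?case by auto
next
  case (Suc n)
  have "x \<in> upper_central G (Suc n) \<longleftrightarrow>
      x \<in> carrier G \<and> (\<forall>y \<in> carrier G. commutator G x y \<in> upper_central G n)"
    by (simp add: commutator_def)
  also have "\<dots> \<longleftrightarrow> x \<in> carrier G \<and> (\<forall>y \<in> carrier G. \<forall>ys \<in> lists (carrier G).
      length ys = n \<longrightarrow> iterated_commutator G x (y # ys) = \<one>)"
    by (auto simp: Suc.IH)
  also have "\<dots> \<longleftrightarrow> x \<in> carrier G \<and> (\<forall>ys \<in> lists (carrier G).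
      length ys = Suc n \<longrightarrow> iterated_commutator G x ys = \<one>)"
    by (metis (no_types, lifting) Cons_in_lists_iff length_Suc_conv)
  finally show ?case .
qed

text \<open>Lifting the arguments along a surjection lets the commutators be computed before the homomorphism is applied.\<close>

lemma (in group_hom) upper_central_surj_iff:
  assumes surj: "h ` carrier G = carrier H" and x: "x \<in> carrier G"
  shows "h x \<in> upper_central H n \<longleftrightarrow>
    (\<forall>ys \<in> lists (carrier G). length ys = n \<longrightarrow> h (iterated_commutator G x ys) = \<one>\<^bsub>H\<^esub>)"
proof -
  have "lists (carrier H) = map h ` lists (carrier G)"
    by (simp flip: surj add: lists_image)
  then show ?thesis
    using x by (auto simp: H.upper_central_iff hom_iterated_commutator)
qed

lemma (in normal) upper_central_quotient_iff:
  assumes "x \<in> carrier G"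
  shows "H #> x \<in> upper_central (G Mod H) n \<longleftrightarrow>
    (\<forall>ys \<in> lists (carrier G). length ys = n \<longrightarrow> iterated_commutator G x ys \<in> H)"
proof -
  interpret Q: group "G Mod H" by (rule factorgroup_is_group)
  interpret q: group_hom G "G Mod H" "\<lambda>x. H #> x"
    by unfold_locales (rule r_coset_hom_Mod)
  have "H #> z = \<one>\<^bsub>G Mod H\<^esub> \<longleftrightarrow> z \<in> H" if "z \<in> carrier G" for z
    using coset_join1[OF _ that subgroup_axioms] coset_join2[OF that subgroup_axioms]
    by (metis one_FactGroup)
  then show ?thesis
    using q.upper_central_surj_iff[OF _ assms, of n] assms
    by (auto simp: carrier_FactGroup iterated_commutator_closed)
qed

lemma (in normal) nilpotent_quotient_iff:
  "nilpotent_group (G Mod H) \<longleftrightarrow>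
     (\<exists>n. \<forall>x \<in> carrier G. \<forall>ys \<in> lists (carrier G). length ys = n \<longrightarrow> iterated_commutator G x ys \<in> H)"
proof -
  interpret Q: group "G Mod H" by (rule factorgroup_is_group)
  have "upper_central (G Mod H) n = carrier (G Mod H) \<longleftrightarrow>
      (\<forall>x \<in> carrier G. H #> x \<in> upper_central (G Mod H) n)" for n
  proof -
    have "upper_central (G Mod H) n \<subseteq> carrier (G Mod H)"
      using Q.upper_central_iff by blast
    then show ?thesis
      by (auto simp: carrier_FactGroup)
  qed
  then show ?thesis
    by (simp add: nilpotent_group_def Q.group_axioms upper_central_quotient_iff)
qed

lemma (in group)
  assumes H: "subgroup H G" and N: "N \<lhd> G\<lparr>carrier := H\<rparr>"
  shows nilpotent_subgroup_quotient_iff: "nilpotent_group (G\<lparr>carrier := H\<rparr> Mod N) \<longleftrightarrow>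
      (\<exists>n. \<forall>x \<in> H. \<forall>ys \<in> lists H. length ys = n \<longrightarrow> iterated_commutator G x ys \<in> N)"
    and hypercentral_subgroup_quotient_iff: "x \<in> H \<Longrightarrow>
      N #>\<^bsub>G\<lparr>carrier := H\<rparr>\<^esub> x \<in> finite_hypercenter (G\<lparr>carrier := H\<rparr> Mod N) \<longleftrightarrow>
      (\<exists>n. \<forall>ys \<in> lists H. length ys = n \<longrightarrow> iterated_commutator G x ys \<in> N)"
  using normal.nilpotent_quotient_iff[OF N] normal.upper_central_quotient_iff[OF N]
  by (auto simp: iterated_commutator_subgroup[OF H] finite_hypercenter_def)

text \<open>For a subgroup this is nilpotency; it is stated for subsets so that it is visibly inherited by smaller sets.\<close>

definition nilpotent_on :: "('a, 'b) monoid_scheme \<Rightarrow> 'a set \<Rightarrow> bool" where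
  "nilpotent_on G S \<longleftrightarrow>
     (\<exists>n. \<forall>x \<in> S. \<forall>ys \<in> lists S. length ys = n \<longrightarrow> iterated_commutator G x ys = \<one>\<^bsub>G\<^esub>)"

lemma nilpotent_on_mono: "nilpotent_on G S \<Longrightarrow> S' \<subseteq> S \<Longrightarrow> nilpotent_on G S'"
  unfolding nilpotent_on_def by (meson lists_mono subsetD)

lemma (in group) iterated_commutator_vanishes_later:
  assumes S: "S \<subseteq> carrier G" "x \<in> S" "ys \<in> lists S" "n \<le> length ys"
    and van: "\<forall>ys \<in> lists S. length ys = n \<longrightarrow> iterated_commutator G x ys = \<one>"
  shows "iterated_commutator G x ys = \<one>"
proof -
  have "iterated_commutator G x ys = iterated_commutator G (iterated_commutator G x (take n ys)) (drop n ys)"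
    by (simp flip: foldl_append)
  also have "iterated_commutator G x (take n ys) = \<one>"
    using assms by (auto intro!: van[rule_format] dest: in_set_takeD)
  also have "iterated_commutator G \<one> (drop n ys) = \<one>"
    using S by (intro iterated_commutator_one) (auto dest: in_set_dropD)
  finally show ?thesis .
qed

section \<open>Closed subgroups of profinite groups\<close>

lemma closed_generate_minimal:
  "subgroup K G \<Longrightarrow> closedin T K \<Longrightarrow> A \<subseteq> K \<Longrightarrow> closed_generate G T A \<subseteq> K"
  by (auto simp: closed_generate_def)

lemma closed_generate_incl: "A \<subseteq> closed_generate G T A"
  by (auto simp: closed_generate_def)

context profinite_group
begin

lemma carrier_closed: "closedin T (carrier G)"
  by (metis topspace_eq closedin_topspace)

lemma closed_generate_subgroup:
  assumes "A \<subseteq> carrier G"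
  shows "subgroup (closed_generate G T A) G" "closedin T (closed_generate G T A)"
proof -
  have ne: "{H. subgroup H G \<and> closedin T H \<and> A \<subseteq> H} \<noteq> {}"
    using assms carrier_closed subgroup_self by blast
  show "subgroup (closed_generate G T A) G"
    unfolding closed_generate_def using ne by (intro subgroups_Inter) auto
  show "closedin T (closed_generate G T A)"
    unfolding closed_generate_def using ne by (intro closedin_Inter) auto
qed

lemma closed_subgroup_profinite:
  assumes K: "subgroup K G" "closedin T K"
  shows "profinite_group (G\<lparr>carrier := K\<rparr>) (subtopology T K)"
proof -
  have sub: "K \<subseteq> carrier G" by (rule subgroup.subset[OF K(1)])
  interpret K: group "G\<lparr>carrier := K\<rparr>" by (rule subgroup_imp_group[OF K(1)])
  have top: "topspace (subtopology T K) = K"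
    using sub topspace_eq by auto
  show ?thesis
  proof unfold_locales
    show "topspace (subtopology T K) = carrier (G\<lparr>carrier := K\<rparr>)"
      using top by simp
    show "continuous_map (prod_topology (subtopology T K) (subtopology T K)) (subtopology T K)
        (\<lambda>(x, y). x \<otimes>\<^bsub>G\<lparr>carrier := K\<rparr>\<^esub> y)"
      using continuous_map_from_subtopology[OF continuous_mult, of "K \<times> K"] subgroup.m_closed[OF K(1)]
      by (auto simp: continuous_map_in_subtopology subtopology_Times)
    have "continuous_map (subtopology T K) T (\<lambda>x. inv\<^bsub>G\<lparr>carrier := K\<rparr>\<^esub> x)"
      by (rule continuous_map_eq[OF continuous_map_from_subtopology[OF continuous_inv]])
        (auto simp: m_inv_consistent[OF K(1)])
    then show "continuous_map (subtopology T K) (subtopology T K) (\<lambda>x. inv\<^bsub>G\<lparr>carrier := K\<rparr>\<^esub> x)"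
      using subgroup.m_inv_closed[OF K(1)] by (auto simp: continuous_map_in_subtopology m_inv_consistent[OF K(1)])
    show "compact_space (subtopology T K)"
      using K(2) compact closedin_compact_space compact_space_subtopology by blast
    show "Hausdorff_space (subtopology T K)"
      by (simp add: Hausdorff Hausdorff_space_subtopology)
    show "\<exists>a. S \<subseteq> {a}" if "connectedin (subtopology T K) S" for S
      using that totally_disconnected by (auto simp: connectedin_subtopology)
  qed
qed

end

section \<open>Products of finite groups\<close>

locale finite_group_family =
  fixes \<Gamma> :: "nat \<Rightarrow> nat monoid"
  assumes group_factor: "\<And>i. group (\<Gamma> i)"
    and finite_factor: "\<And>i. finite (carrier (\<Gamma> i))"
begin

definition prod_grp :: "(nat \<Rightarrow> nat) monoid" where
  "prod_grp = product_group UNIV \<Gamma>"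

definition prod_top :: "(nat \<Rightarrow> nat) topology" where
  "prod_top = product_topology (\<lambda>i. discrete_topology (carrier (\<Gamma> i))) UNIV"

sublocale factor: group "\<Gamma> i" for i by (rule group_factor)

sublocale G: group prod_grp
  unfolding prod_grp_def by (simp add: group_factor)

lemma carrier_prod_grp: "carrier prod_grp = {x. \<forall>i. x i \<in> carrier (\<Gamma> i)}"
  by (auto simp: prod_grp_def PiE_iff)

lemma mult_prod_grp [simp]: "x \<otimes>\<^bsub>prod_grp\<^esub> y = (\<lambda>i. x i \<otimes>\<^bsub>\<Gamma> i\<^esub> y i)"
  by (simp add: prod_grp_def restrict_def)

lemma one_prod_grp [simp]: "\<one>\<^bsub>prod_grp\<^esub> = (\<lambda>i. \<one>\<^bsub>\<Gamma> i\<^esub>)"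
  by (simp add: prod_grp_def restrict_def)

lemma inv_prod_grp: "x \<in> carrier prod_grp \<Longrightarrow> inv\<^bsub>prod_grp\<^esub> x = (\<lambda>i. inv\<^bsub>\<Gamma> i\<^esub> x i)"
  by (simp add: prod_grp_def group_factor restrict_def)

lemma topspace_prod_top [simp]: "topspace prod_top = carrier prod_grp"
  by (simp add: prod_top_def prod_grp_def)

sublocale proj: group_hom prod_grp "\<Gamma> i" "\<lambda>x. x i" for i
  by unfold_locales (auto simp: hom_def carrier_prod_grp)

(* As a rewrite rule this would match every membership statement x \<in> carrier (\<Gamma> i) and loop. *)
declare proj.hom_closed [simp del]

lemma proj_surj: "(\<lambda>x. x i) ` carrier prod_grp = carrier (\<Gamma> i)"
proof
  show "carrier (\<Gamma> i) \<subseteq> (\<lambda>x. x i) ` carrier prod_grp"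
  proof
    fix a assume "a \<in> carrier (\<Gamma> i)"
    then have "(\<lambda>j. if j = i then a else \<one>\<^bsub>\<Gamma> j\<^esub>) \<in> carrier prod_grp"
      by (simp add: carrier_prod_grp)
    then show "a \<in> (\<lambda>x. x i) ` carrier prod_grp" by (rule rev_image_eqI) simp
  qed
qed (auto simp: carrier_prod_grp)

lemma continuous_proj: "continuous_map prod_top (discrete_topology (carrier (\<Gamma> i))) (\<lambda>x. x i)"
  unfolding prod_top_def by (rule continuous_map_product_projection) simp

lemma clopen_cylinder:
  assumes "A \<subseteq> carrier (\<Gamma> i)"
  shows "openin prod_top {x \<in> carrier prod_grp. x i \<in> A}"
    and "closedin prod_top {x \<in> carrier prod_grp. x i \<in> A}"
  using openin_continuous_map_preimage[OF continuous_proj]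
    closedin_continuous_map_preimage[OF continuous_proj] assms
  by force+

text \<open>A basic neighbourhood of the identity restricts only finitely many coordinates, so it contains the
kernel of the projection to an initial segment of the factors.\<close>

lemma open_contains_congruence_subgroup:
  assumes U: "openin prod_top U" and one: "\<one>\<^bsub>prod_grp\<^esub> \<in> U"
  obtains n where "\<And>x. x \<in> carrier prod_grp \<Longrightarrow> (\<And>i. i < n \<Longrightarrow> x i = \<one>\<^bsub>\<Gamma> i\<^esub>) \<Longrightarrow> x \<in> U"
proof -
  obtain V where V: "finite {i. V i \<noteq> carrier (\<Gamma> i)}"
      "\<one>\<^bsub>prod_grp\<^esub> \<in> Pi\<^sub>E UNIV V" "Pi\<^sub>E UNIV V \<subseteq> U"
    using product_topology_open_contains_basis[OF U[unfolded prod_top_def] one] by auto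
  obtain n where n: "\<And>i. V i \<noteq> carrier (\<Gamma> i) \<Longrightarrow> i < n"
    using V(1) unfolding finite_nat_set_iff_bounded by blast
  show thesis
  proof (rule that[of n])
    fix x assume x: "x \<in> carrier prod_grp" "\<And>i. i < n \<Longrightarrow> x i = \<one>\<^bsub>\<Gamma> i\<^esub>"
    have "x i \<in> V i" for i
      using x n[of i] V(2) by (cases "i < n") (auto simp: carrier_prod_grp PiE_iff)
    then show "x \<in> U" using V(3) by auto
  qed
qed

lemma profinite: "profinite_group prod_grp prod_top"
proof unfold_locales
  show "topspace prod_top = carrier prod_grp" by simp
  have "continuous_map (prod_topology prod_top prod_top) (discrete_topology (carrier (\<Gamma> i)))
      (\<lambda>p. fst p i \<otimes>\<^bsub>\<Gamma> i\<^esub> snd p i)" for i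
  proof -
    let ?D = "discrete_topology (carrier (\<Gamma> i))"
    have 1: "continuous_map (prod_topology prod_top prod_top) (prod_topology ?D ?D) (\<lambda>p. (fst p i, snd p i))"
      using continuous_map_compose[OF continuous_map_fst continuous_proj[of i]]
        continuous_map_compose[OF continuous_map_snd continuous_proj[of i]]
      by (auto simp: continuous_map_paired o_def)
    have 2: "continuous_map (prod_topology ?D ?D) ?D (\<lambda>(a, b). a \<otimes>\<^bsub>\<Gamma> i\<^esub> b)"
      by (auto simp flip: prod_topology_discrete_topology)
    show ?thesis
      using continuous_map_compose[OF 1 2] by (simp add: o_def)
  qed
  then show "continuous_map (prod_topology prod_top prod_top) prod_top (\<lambda>(x, y). x \<otimes>\<^bsub>prod_grp\<^esub> y)"
    by (subst (3) prod_top_def) (simp add: continuous_map_componentwise_UNIV case_prod_unfold)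
  have "continuous_map prod_top (discrete_topology (carrier (\<Gamma> i))) (\<lambda>x. inv\<^bsub>\<Gamma> i\<^esub> x i)" for i
  proof -
    have "continuous_map (discrete_topology (carrier (\<Gamma> i))) (discrete_topology (carrier (\<Gamma> i))) (\<lambda>a. inv\<^bsub>\<Gamma> i\<^esub> a)"
      by auto
    from continuous_map_compose[OF continuous_proj this] show ?thesis by (simp add: o_def)
  qed
  then have "continuous_map prod_top prod_top (\<lambda>x i. inv\<^bsub>\<Gamma> i\<^esub> x i)"
    by (subst (2) prod_top_def) (simp add: continuous_map_componentwise_UNIV)
  then show "continuous_map prod_top prod_top (\<lambda>x. inv\<^bsub>prod_grp\<^esub> x)"
    by (rule continuous_map_eq) (simp add: inv_prod_grp)
  show "compact_space prod_top"
    unfolding prod_top_def by (simp add: compact_space_product_topology compact_space_discrete_topology finite_factor)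
  show "Hausdorff_space prod_top"
    unfolding prod_top_def by (simp add: Hausdorff_space_product_topology)
  show "\<exists>a. S \<subseteq> {a}" if S: "connectedin prod_top S" for S
  proof -
    have "\<exists>a. (\<lambda>x. x i) ` S \<subseteq> {a}" for i
      using connectedin_continuous_map_image[OF continuous_proj S, of i]
      by (simp add: connectedin_discrete_topology)
    then obtain a where a: "\<And>i. (\<lambda>x. x i) ` S \<subseteq> {a i}" by metis
    have "S \<subseteq> {a}"
      using a by (fastforce simp: fun_eq_iff)
    then show ?thesis by blast
  qed
qed

sublocale profinite_group prod_grp prod_top by (rule profinite)

lemma solvable_prod_grp:
  assumes "\<And>i. (derived (\<Gamma> i) ^^ n) (carrier (\<Gamma> i)) = {\<one>\<^bsub>\<Gamma> i\<^esub>}"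
  shows "solvable prod_grp"
proof -
  have "x = \<one>\<^bsub>prod_grp\<^esub>" if x: "x \<in> (derived prod_grp ^^ n) (carrier prod_grp)" for x
  proof -
    have "x i \<in> {\<one>\<^bsub>\<Gamma> i\<^esub>}" for i
      using x proj.exp_of_derived_img[of "carrier prod_grp" n i, OF subset_refl] proj_surj assms
      by fastforce
    then show ?thesis by (simp add: fun_eq_iff)
  qed
  moreover have "\<one>\<^bsub>prod_grp\<^esub> \<in> (derived prod_grp ^^ n) (carrier prod_grp)"
    using G.exp_of_derived_is_subgroup[OF G.subgroup_self] subgroup.one_closed by blast
  ultimately show ?thesis
    unfolding G.solvable_iff_trivial_derived_seq by blast
qed

lemma proj_restrict:
  assumes "subgroup H prod_grp"
  shows "group_hom (prod_grp\<lparr>carrier := H\<rparr>) (\<Gamma> i) (\<lambda>x. x i)"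
proof -
  interpret H: group "prod_grp\<lparr>carrier := H\<rparr>" by (rule G.subgroup_imp_group[OF assms])
  show ?thesis
    using subgroup.subset[OF assms] by unfold_locales (auto simp: hom_def carrier_prod_grp)
qed

lemma open_normal_proj_kernel:
  assumes "subgroup H prod_grp"
  shows "open_normal (prod_grp\<lparr>carrier := H\<rparr>) (subtopology prod_top H) {x \<in> H. x i = \<one>\<^bsub>\<Gamma> i\<^esub>}"
proof -
  have "{x \<in> H. x i = \<one>\<^bsub>\<Gamma> i\<^esub>} = H \<inter> {x \<in> carrier prod_grp. x i \<in> {\<one>\<^bsub>\<Gamma> i\<^esub>}}"
    using subgroup.subset[OF assms] by blast
  moreover have "openin (subtopology prod_top H) (H \<inter> {x \<in> carrier prod_grp. x i \<in> {\<one>\<^bsub>\<Gamma> i\<^esub>}})"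
    by (intro openin_subtopology_Int2 clopen_cylinder(1)) simp
  ultimately show ?thesis
    using group_hom.normal_kernel[OF proj_restrict[OF assms], of i]
    by (simp add: open_normal_def kernel_def)
qed

text \<open>An open subgroup contains almost all factors and therefore still projects onto them. The kernel of
such a projection is open and normal, and an element that is hypercentral modulo this kernel has
a hypercentral coordinate.\<close>

lemma hypercenter_open_subgroup:
  assumes H: "subgroup H prod_grp" "openin prod_top H"
    and x: "x \<in> hypercenter (prod_grp\<lparr>carrier := H\<rparr>) (subtopology prod_top H)"
  obtains n where "\<And>i. n \<le> i \<Longrightarrow> x i \<in> finite_hypercenter (\<Gamma> i)"
proof -
  have xH: "x \<in> H" using x by (simp add: hypercenter_def)
  have Hc: "H \<subseteq> carrier prod_grp" by (rule subgroup.subset[OF H(1)])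
  obtain n where n: "\<And>x. x \<in> carrier prod_grp \<Longrightarrow> (\<And>i. i < n \<Longrightarrow> x i = \<one>\<^bsub>\<Gamma> i\<^esub>) \<Longrightarrow> x \<in> H"
    using open_contains_congruence_subgroup[OF H(2)] subgroup.one_closed[OF H(1)] by metis
  interpret H: group "prod_grp\<lparr>carrier := H\<rparr>" by (rule G.subgroup_imp_group[OF H(1)])
  show thesis
  proof (rule that)
    fix i assume i: "n \<le> i"
    let ?N = "{x \<in> H. x i = \<one>\<^bsub>\<Gamma> i\<^esub>}"
    have surj: "(\<lambda>x. x i) ` H = carrier (\<Gamma> i)"
    proof
      show "carrier (\<Gamma> i) \<subseteq> (\<lambda>x. x i) ` H"
      proof
        fix a assume "a \<in> carrier (\<Gamma> i)"
        then have "(\<lambda>j. if j = i then a else \<one>\<^bsub>\<Gamma> j\<^esub>) \<in> H"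
          using i by (intro n) (auto simp: carrier_prod_grp)
        then show "a \<in> (\<lambda>x. x i) ` H" by (rule rev_image_eqI) simp
      qed
    qed (use Hc in \<open>auto simp: carrier_prod_grp\<close>)
    have N: "open_normal (prod_grp\<lparr>carrier := H\<rparr>) (subtopology prod_top H) ?N"
      by (rule open_normal_proj_kernel[OF H(1)])
    then obtain m where m: "\<forall>ys \<in> lists H. length ys = m \<longrightarrow> iterated_commutator prod_grp x ys \<in> ?N"
      using x G.hypercentral_subgroup_quotient_iff[OF H(1) _ xH, of ?N]
      by (auto simp: hypercenter_def open_normal_def)
    have "x i \<in> upper_central (\<Gamma> i) m"
      using group_hom.upper_central_surj_iff[OF proj_restrict[OF H(1)], of i x m] m surj xH
        G.iterated_commutator_subgroup[OF H(1) xH] by simp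
    then show "x i \<in> finite_hypercenter (\<Gamma> i)"
      by (auto simp: finite_hypercenter_def)
  qed
qed

text \<open>In one direction, the closed subgroup generated by \<open>x\<close> and \<open>y\<close> maps onto the groups generated by
the coordinates, and the kernels of these maps are open and normal. Conversely, an open normal subgroup
contains all elements with trivial coordinates below some \<open>n\<close>, so only finitely many nilpotency
classes matter, and iterated commutators that are long enough for all of them lie in it.\<close>

lemma pronilpotentizer_eq:
  assumes x: "x \<in> carrier prod_grp"
  shows "pronilpotentizer prod_grp prod_top x =
    {y \<in> carrier prod_grp. \<forall>i. nilpotent_on (\<Gamma> i) (generate (\<Gamma> i) {x i, y i})}"
proof -
  have "pronilpotent_group (prod_grp\<lparr>carrier := H\<rparr>) (subtopology prod_top H) \<longleftrightarrow>
      (\<forall>i. nilpotent_on (\<Gamma> i) (generate (\<Gamma> i) {x i, y i}))"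
    if y: "y \<in> carrier prod_grp" and H_def: "H = closed_generate prod_grp prod_top {x, y}" for y H
  proof -
    have xy: "{x, y} \<subseteq> carrier prod_grp" using x y by simp
    have xyi: "{x i, y i} \<subseteq> carrier (\<Gamma> i)" for i
      using x y by (simp add: carrier_prod_grp)
    have H: "subgroup H prod_grp" "closedin prod_top H" "{x, y} \<subseteq> H"
      using closed_generate_subgroup[OF xy] closed_generate_incl[of "{x, y}"] unfolding H_def by auto
    have Hc: "H \<subseteq> carrier prod_grp" by (rule subgroup.subset[OF H(1)])
    interpret H: group "prod_grp\<lparr>carrier := H\<rparr>" by (rule G.subgroup_imp_group[OF H(1)])
    show ?thesis
    proof (intro iffI allI)
      fix i assume pro: "pronilpotent_group (prod_grp\<lparr>carrier := H\<rparr>) (subtopology prod_top H)"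
      let ?N = "{x \<in> H. x i = \<one>\<^bsub>\<Gamma> i\<^esub>}"
      have "open_normal (prod_grp\<lparr>carrier := H\<rparr>) (subtopology prod_top H) ?N"
        by (rule open_normal_proj_kernel[OF H(1)])
      then obtain n where n: "\<forall>x \<in> H. \<forall>ys \<in> lists H. length ys = n \<longrightarrow> iterated_commutator prod_grp x ys \<in> ?N"
        using pro G.nilpotent_subgroup_quotient_iff[OF H(1), of ?N]
        by (auto simp: pronilpotent_group_def open_normal_def)
      have "subgroup ((\<lambda>x. x i) ` H) (\<Gamma> i)"
        using group_hom.img_is_subgroup[OF proj_restrict[OF H(1)], of i] by simp
      then have img: "generate (\<Gamma> i) {x i, y i} \<subseteq> (\<lambda>x. x i) ` H"
        using H(3) by (intro factor.generate_subgroup_incl) auto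
      have "iterated_commutator (\<Gamma> i) a bs = \<one>\<^bsub>\<Gamma> i\<^esub>"
        if ab: "a \<in> (\<lambda>x. x i) ` H" "bs \<in> lists ((\<lambda>x. x i) ` H)" "length bs = n" for a bs
      proof -
        obtain z where z1: "z \<in> H" "a = z i" using ab(1) by blast
        have "bs \<in> map (\<lambda>x. x i) ` lists H" using ab(2) by (simp only: lists_image)
        then obtain zs where "zs \<in> lists H" "bs = map (\<lambda>x. x i) zs" by blast
        note z = z1 this
        have "iterated_commutator prod_grp z zs \<in> ?N"
          using n z ab by auto
        moreover have "iterated_commutator prod_grp z zs i = iterated_commutator (\<Gamma> i) a bs"
          using z Hc proj.hom_iterated_commutator[of z zs i] lists_mono[OF Hc] by auto
        ultimately show ?thesis by simp
      qed
      then have "nilpotent_on (\<Gamma> i) ((\<lambda>x. x i) ` H)"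
        unfolding nilpotent_on_def by blast
      then show "nilpotent_on (\<Gamma> i) (generate (\<Gamma> i) {x i, y i})"
        using img nilpotent_on_mono by blast
    next
      assume nil: "\<forall>i. nilpotent_on (\<Gamma> i) (generate (\<Gamma> i) {x i, y i})"
      have Hi: "z i \<in> generate (\<Gamma> i) {x i, y i}" if "z \<in> H" for z i
      proof -
        let ?K = "{z \<in> carrier prod_grp. z i \<in> generate (\<Gamma> i) {x i, y i}}"
        have gen: "subgroup (generate (\<Gamma> i) {x i, y i}) (\<Gamma> i)"
          by (rule factor.generate_is_subgroup[OF xyi])
        have "subgroup ?K prod_grp"
          using subgroup.m_closed[OF gen] subgroup.one_closed[OF gen] subgroup.m_inv_closed[OF gen]
            G.m_closed G.inv_closed G.one_closed
          by (intro subgroup.intro) (auto simp: inv_prod_grp simp del: mult_prod_grp)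
        then have "H \<subseteq> ?K"
          unfolding H_def
          using clopen_cylinder(2)[OF subgroup.subset[OF gen]] xy
          by (intro closed_generate_minimal) (auto intro: generate.incl)
        with that show ?thesis by auto
      qed
      obtain c where c: "\<And>i a bs. a \<in> generate (\<Gamma> i) {x i, y i} \<Longrightarrow> bs \<in> lists (generate (\<Gamma> i) {x i, y i}) \<Longrightarrow>
          length bs = c i \<Longrightarrow> iterated_commutator (\<Gamma> i) a bs = \<one>\<^bsub>\<Gamma> i\<^esub>"
        using nil unfolding nilpotent_on_def by metis
      show "pronilpotent_group (prod_grp\<lparr>carrier := H\<rparr>) (subtopology prod_top H)"
        unfolding pronilpotent_group_def
      proof (intro conjI allI impI)
        show "profinite_group (prod_grp\<lparr>carrier := H\<rparr>) (subtopology prod_top H)"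
          by (rule closed_subgroup_profinite[OF H(1,2)])
        fix N assume "open_normal (prod_grp\<lparr>carrier := H\<rparr>) (subtopology prod_top H) N"
        then have N: "N \<lhd> prod_grp\<lparr>carrier := H\<rparr>" "openin (subtopology prod_top H) N"
          by (auto simp: open_normal_def)
        obtain U where U: "openin prod_top U" "N = U \<inter> H"
          using N(2) by (auto simp: openin_subtopology)
        have "\<one>\<^bsub>prod_grp\<^esub> \<in> U"
          using U(2) subgroup.one_closed[OF normal_imp_subgroup[OF N(1)]] by simp
        then obtain n where n: "\<And>x. x \<in> carrier prod_grp \<Longrightarrow> (\<And>i. i < n \<Longrightarrow> x i = \<one>\<^bsub>\<Gamma> i\<^esub>) \<Longrightarrow> x \<in> U"
          using open_contains_congruence_subgroup[OF U(1)] by metis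
        \<comment> \<open>Any common upper bound of the finitely many classes would do.\<close>
        define m where "m = (\<Sum>i<n. c i)"
        have "iterated_commutator prod_grp z zs \<in> N"
          if z: "z \<in> H" "zs \<in> lists H" "length zs = m" for z zs
        proof -
          have zc: "z \<in> carrier prod_grp" "zs \<in> lists (carrier prod_grp)"
            using z Hc lists_mono[OF Hc] by auto
          have "iterated_commutator prod_grp z zs i = \<one>\<^bsub>\<Gamma> i\<^esub>" if i: "i < n" for i
          proof -
            have "c i \<le> m"
              unfolding m_def using i by (intro member_le_sum) auto
            then have "iterated_commutator (\<Gamma> i) (z i) (map (\<lambda>x. x i) zs) = \<one>\<^bsub>\<Gamma> i\<^esub>"
              using factor.generate_incl[OF xyi] Hi z c
              by (intro factor.iterated_commutator_vanishes_later[of "generate (\<Gamma> i) {x i, y i}" _ _ _ "c i"]) auto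
            then show ?thesis
              using proj.hom_iterated_commutator[OF zc] by simp
          qed
          then have "iterated_commutator prod_grp z zs \<in> U"
            by (intro n G.iterated_commutator_closed zc)
          moreover have "iterated_commutator prod_grp z zs \<in> H"
            using H.iterated_commutator_closed[of z zs] z G.iterated_commutator_subgroup[OF H(1) z(1,2)] by simp
          ultimately show ?thesis using U(2) by simp
        qed
        then show "nilpotent_group (prod_grp\<lparr>carrier := H\<rparr> Mod N)"
          using G.nilpotent_subgroup_quotient_iff[OF H(1) N(1)] by blast
      qed
    qed
  qed
  then show ?thesis by (auto simp: pronilpotentizer_def)
qed

end

section \<open>Haar measure on a product of finite groups\<close>

context finite_group_family
begin

abbreviation uniform :: "nat \<Rightarrow> nat measure" where
  "uniform i \<equiv> measure_pmf (pmf_of_set (carrier (\<Gamma> i)))"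

abbreviation uniform_prod :: "(nat \<Rightarrow> nat) measure" where
  "uniform_prod \<equiv> Pi\<^sub>M UNIV uniform"

definition haar :: "(nat \<Rightarrow> nat) measure" where
  "haar = restrict_space uniform_prod (carrier prod_grp)"

sublocale U: product_prob_space uniform UNIV
  by unfold_locales

lemma carrier_nonempty: "carrier (\<Gamma> i) \<noteq> {}"
  using factor.one_closed by blast

lemma sets_uniform_prod: "sets uniform_prod = sets borel"
proof -
  have "sets (uniform i) = sets (borel :: nat measure)" for i
    by (simp add: sets_borel_eq_count_space)
  then have "sets uniform_prod = sets (Pi\<^sub>M UNIV (\<lambda>i. borel :: nat measure))"
    by (intro sets_PiM_cong) auto
  then show ?thesis by (simp add: sets_PiM_equal_borel)
qed

lemma space_uniform_prod: "space uniform_prod = UNIV"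
  by (simp add: space_PiM)

lemma prod_top_eq: "prod_top = top_of_set (carrier prod_grp)"
proof -
  have "openin (top_of_set (carrier (\<Gamma> i))) S \<longleftrightarrow> S \<subseteq> carrier (\<Gamma> i)" for i S
    using openin_subset[of "top_of_set (carrier (\<Gamma> i))" S] open_subset[of S "carrier (\<Gamma> i)"] Topological_Spaces.open_discrete[of S]
    by auto
  then have "top_of_set (carrier (\<Gamma> i)) = discrete_topology (carrier (\<Gamma> i))" for i
    by (simp add: topology_eq)
  then have "prod_top = product_topology (\<lambda>i. subtopology euclidean (carrier (\<Gamma> i))) UNIV"
    by (simp add: prod_top_def)
  also have "\<dots> = top_of_set (carrier prod_grp)"
    by (simp add: prod_grp_def euclidean_product_topology flip: subtopology_product_topology)
  finally show ?thesis .
qed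

lemma closed_carrier: "closed (carrier prod_grp)"
proof -
  have "closed ((\<lambda>x. x i) -` carrier (\<Gamma> i))" for i
    by (intro closed_vimage finite_imp_closed finite_factor continuous_on_product_coordinates)
  moreover have "carrier prod_grp = (\<Inter>i. (\<lambda>x. x i) -` carrier (\<Gamma> i))"
    by (auto simp: carrier_prod_grp)
  ultimately show ?thesis by auto
qed

lemma carrier_sets: "carrier prod_grp \<in> sets uniform_prod"
  using closed_carrier by (simp add: sets_uniform_prod)

lemma AE_carrier: "AE x in uniform_prod. x \<in> carrier prod_grp"
proof -
  have "AE x in uniform_prod. x i \<in> carrier (\<Gamma> i)" for i
    by (rule U.AE_component) (auto simp: AE_measure_pmf_iff finite_factor carrier_nonempty)
  then show ?thesis by (simp add: carrier_prod_grp AE_all_countable)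
qed

lemma haar_sets: "sets haar = sigma_sets (topspace prod_top) {U. openin prod_top U}"
proof -
  have "sets haar = (\<inter>) (carrier prod_grp) ` sigma_sets UNIV {S. open S}"
    by (simp add: haar_def sets_restrict_space sets_uniform_prod borel_def)
  also have "\<dots> = sigma_sets (carrier prod_grp) ((\<inter>) (carrier prod_grp) ` {S. open S})"
    using carrier_sets by (intro sigma_sets_Int) (auto simp: sets_uniform_prod borel_def)
  also have "(\<inter>) (carrier prod_grp) ` {S. open S} = {U. openin prod_top U}"
    by (auto simp: prod_top_eq openin_open)
  finally show ?thesis by simp
qed

lemma haar_sets_iff: "A \<in> sets haar \<longleftrightarrow> A \<in> sets uniform_prod \<and> A \<subseteq> carrier prod_grp"
  unfolding haar_def using carrier_sets by (subst sets_restrict_space_iff) (auto simp: space_uniform_prod)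

lemma emeasure_haar: "A \<subseteq> carrier prod_grp \<Longrightarrow> emeasure haar A = emeasure uniform_prod A"
  unfolding haar_def using carrier_sets by (intro emeasure_restrict_space) (auto simp: space_uniform_prod)

lemma emeasure_haar_carrier: "emeasure haar (carrier prod_grp) = 1"
  using AE_carrier carrier_sets
  by (subst emeasure_haar) (auto simp: U.P.emeasure_eq_1_AE)

text \<open>Finite Borel measures on the Polish space of real sequences are regular, and embedding the natural
numbers into the reals in each coordinate carries the measure to that space. The embedding is continuous, so compact
sets have closed preimages, and these are compact inside the compact carrier.\<close>

lemma haar_inner_regular:
  assumes "A \<in> sets haar"
  shows "emeasure haar A = (SUP K \<in> {K. compactin prod_top K \<and> K \<subseteq> A}. emeasure haar K)"
proof (rule antisym)
  have A: "A \<in> sets borel" "A \<subseteq> carrier prod_grp"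
    using assms haar_sets_iff sets_uniform_prod by auto
  define e :: "(nat \<Rightarrow> nat) \<Rightarrow> nat \<Rightarrow> real" where "e x i = real (x i)" for x i
  define r :: "(nat \<Rightarrow> real) \<Rightarrow> nat \<Rightarrow> nat" where "r y i = nat \<lfloor>y i\<rfloor>" for y i
  have re: "r (e x) = x" for x by (simp add: e_def r_def fun_eq_iff)
  have cont: "continuous_on UNIV e"
    unfolding e_def
    by (intro continuous_on_coordinatewise_then_product continuous_on_of_nat continuous_on_product_coordinates)
  have em: "e \<in> measurable uniform_prod borel"
    using borel_measurable_continuous_onI[OF cont] sets_uniform_prod by (metis measurable_cong_sets)
  have "r \<in> measurable borel borel"
    unfolding r_def by (intro measurable_coordinatewise_then_product) measurable
  from measurable_sets[OF this A(1)] have rA: "r -` A \<in> sets borel" by simp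
  let ?\<nu> = "distr uniform_prod borel e"
  have fin: "emeasure ?\<nu> (space ?\<nu>) \<noteq> \<infinity>"
    by (simp add: emeasure_distr[OF em])
  have "emeasure haar A = emeasure ?\<nu> (r -` A)"
    using A rA by (simp add: emeasure_haar emeasure_distr[OF em] space_uniform_prod vimage_def re)
  also have "\<dots> = (SUP K \<in> {K. K \<subseteq> r -` A \<and> compact K}. emeasure ?\<nu> K)"
    by (rule inner_regular[OF _ fin rA]) simp
  also have "\<dots> \<le> (SUP K \<in> {K. compactin prod_top K \<and> K \<subseteq> A}. emeasure haar K)"
  proof (rule SUP_mono)
    fix K assume "K \<in> {K. K \<subseteq> r -` A \<and> compact K}"
    then have K: "K \<subseteq> r -` A" "compact K" by auto
    have KA: "e -` K \<subseteq> A" using K(1) re by force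
    have "closed (e -` K)"
      by (rule closed_vimage[OF compact_imp_closed[OF K(2)] cont])
    then have "closedin prod_top (e -` K)"
      using KA A(2) by (auto simp: prod_top_eq closedin_closed)
    then have "compactin prod_top (e -` K)"
      by (rule closedin_compact_space[OF compact])
    moreover have "emeasure ?\<nu> K = emeasure haar (e -` K)"
      using KA A(2) compact_imp_closed[OF K(2)]
      by (simp add: emeasure_distr[OF em] space_uniform_prod emeasure_haar)
    ultimately show "\<exists>K' \<in> {K. compactin prod_top K \<and> K \<subseteq> A}. emeasure ?\<nu> K \<le> emeasure haar K'"
      using KA by auto
  qed
  finally show "emeasure haar A \<le> (SUP K \<in> {K. compactin prod_top K \<and> K \<subseteq> A}. emeasure haar K)" .
  show "(SUP K \<in> {K. compactin prod_top K \<and> K \<subseteq> A}. emeasure haar K) \<le> emeasure haar A"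
    using assms by (intro SUP_least emeasure_mono) auto
qed

definition translation :: "(nat \<Rightarrow> nat) \<Rightarrow> (nat \<Rightarrow> nat) \<Rightarrow> nat \<Rightarrow> nat" where
  "translation x z = (\<lambda>i. x i \<otimes>\<^bsub>\<Gamma> i\<^esub> z i)"

lemma translation_measurable: "translation x \<in> measurable uniform_prod uniform_prod"
  unfolding translation_def
  by (intro measurable_PiM_single') (auto simp: space_PiM intro!: measurable_compose[OF measurable_component_singleton])

text \<open>Translation permutes the carrier of each factor and so preserves its uniform distribution; a product
measure is determined by its values on cylinders.\<close>

lemma distr_translation:
  assumes x: "x \<in> carrier prod_grp"
  shows "distr uniform_prod uniform_prod (translation x) = uniform_prod"
proof (rule U.PiM_eq)
  fix J :: "nat set" and F assume J: "finite J" and F: "\<And>j. j \<in> J \<Longrightarrow> F j \<in> sets (uniform j)"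
  let ?F = "\<lambda>j. (\<lambda>a. x j \<otimes>\<^bsub>\<Gamma> j\<^esub> a) -` F j"
  have uni: "emeasure (uniform j) (?F j) = emeasure (uniform j) (F j)" for j
  proof -
    have "x j \<in> carrier (\<Gamma> j)" using x by (simp add: carrier_prod_grp)
    then have "bij_betw (\<lambda>a. x j \<otimes>\<^bsub>\<Gamma> j\<^esub> a) (carrier (\<Gamma> j)) (carrier (\<Gamma> j))"
      using factor.inj_on_cmult factor.surj_const_mult by (simp add: bij_betw_def)
    then have "map_pmf (\<lambda>a. x j \<otimes>\<^bsub>\<Gamma> j\<^esub> a) (pmf_of_set (carrier (\<Gamma> j))) = pmf_of_set (carrier (\<Gamma> j))"
      by (intro map_pmf_of_set_bij_betw carrier_nonempty finite_factor)
    then show ?thesis by (metis emeasure_map_pmf)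
  qed
  have "emeasure (distr uniform_prod uniform_prod (translation x)) (prod_emb UNIV uniform J (Pi\<^sub>E J F)) =
      emeasure uniform_prod (translation x -` prod_emb UNIV uniform J (Pi\<^sub>E J F))"
    using J by (subst emeasure_distr[OF translation_measurable]) (auto simp: space_uniform_prod)
  also have "translation x -` prod_emb UNIV uniform J (Pi\<^sub>E J F) = prod_emb UNIV uniform J (Pi\<^sub>E J ?F)"
    by (auto simp: prod_emb_def translation_def PiE_iff)
  also have "emeasure uniform_prod \<dots> = (\<Prod>j\<in>J. emeasure (uniform j) (F j))"
    using J by (subst U.emeasure_PiM_emb) (auto simp: uni)
  finally show "emeasure (distr uniform_prod uniform_prod (translation x)) (prod_emb UNIV uniform J (Pi\<^sub>E J F)) =
      (\<Prod>j\<in>J. emeasure (uniform j) (F j))" .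
qed simp

lemma haar_left_invariant:
  assumes x: "x \<in> carrier prod_grp" and A: "A \<in> sets haar"
  shows "emeasure haar (x <#\<^bsub>prod_grp\<^esub> A) = emeasure haar A"
proof -
  have Ac: "A \<subseteq> carrier prod_grp" and As: "A \<in> sets uniform_prod"
    using A by (auto simp: haar_sets_iff)
  let ?y = "inv\<^bsub>prod_grp\<^esub> x"
  have y: "?y \<in> carrier prod_grp" using x by simp
  have coset: "x <#\<^bsub>prod_grp\<^esub> A = translation ?y -` A \<inter> carrier prod_grp"
  proof (intro equalityI subsetI)
    fix z assume "z \<in> x <#\<^bsub>prod_grp\<^esub> A"
    then obtain a where a: "a \<in> A" "z = x \<otimes>\<^bsub>prod_grp\<^esub> a" by (auto simp: l_coset_def)
    then have "?y \<otimes>\<^bsub>prod_grp\<^esub> z = a"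
      using x Ac by (metis G.inv_solve_left' G.m_closed subsetD)
    moreover have "z \<in> carrier prod_grp" using a x Ac by (metis G.m_closed subsetD)
    ultimately show "z \<in> translation ?y -` A \<inter> carrier prod_grp"
      using a by (simp add: translation_def)
  next
    fix z assume z: "z \<in> translation ?y -` A \<inter> carrier prod_grp"
    then have "?y \<otimes>\<^bsub>prod_grp\<^esub> z \<in> A" by (simp add: translation_def)
    moreover have "z = x \<otimes>\<^bsub>prod_grp\<^esub> (?y \<otimes>\<^bsub>prod_grp\<^esub> z)"
      using x z by (metis G.inv_solve_left G.m_closed IntD2 y)
    ultimately show "z \<in> x <#\<^bsub>prod_grp\<^esub> A" unfolding l_coset_def by blast
  qed
  have "emeasure haar (x <#\<^bsub>prod_grp\<^esub> A) = emeasure uniform_prod (translation ?y -` A \<inter> carrier prod_grp)"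
    unfolding coset by (rule emeasure_haar) simp
  also have "\<dots> = emeasure uniform_prod (translation ?y -` A)"
    using AE_carrier carrier_sets measurable_sets[OF translation_measurable As, of ?y]
    by (intro emeasure_eq_AE) (auto simp: space_uniform_prod)
  also have "\<dots> = emeasure (distr uniform_prod uniform_prod (translation ?y)) A"
    using As by (subst emeasure_distr[OF translation_measurable]) (auto simp: space_uniform_prod)
  also have "\<dots> = emeasure haar A"
    using Ac by (simp add: distr_translation[OF y] emeasure_haar)
  finally show ?thesis .
qed

lemma normalized_haar: "normalized_haar_measure prod_grp prod_top haar"
  unfolding normalized_haar_measure_def
  using haar_sets emeasure_haar_carrier haar_left_invariant haar_inner_regular by blast

text \<open>The complement of the box is the union over \<open>i\<close> of the events that the \<open>i\<close>-th coordinate is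
exceptional, and measures are countably subadditive.\<close>

lemma measure_haar_box:
  assumes sm: "summable d"
    and d: "\<And>i. real (card {a \<in> carrier (\<Gamma> i). \<not> P i a}) / real (card (carrier (\<Gamma> i))) \<le> d i"
  shows "1 - suminf d \<le> measure haar {x \<in> carrier prod_grp. \<forall>i. P i (x i)}"
proof -
  let ?B = "\<lambda>i. {x. \<not> P i (x i)}"
  have Bs: "?B i \<in> sets uniform_prod" for i
    using measurable_sets[OF measurable_component_singleton[of i UNIV uniform], of "{a. \<not> P i a}"]
    by (simp add: space_uniform_prod vimage_def)
  have B: "measure uniform_prod (?B i) \<le> d i" for i
  proof -
    have "measure uniform_prod (?B i) = measure (uniform i) {a. \<not> P i a}"
      using U.emeasure_PiM_Collect_single[of i "{a. \<not> P i a}"]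
      by (simp add: measure_def space_uniform_prod)
    also have "\<dots> \<le> d i"
      using d[of i] by (simp add: measure_pmf_of_set carrier_nonempty finite_factor Int_def)
    finally show ?thesis .
  qed
  have smB: "summable (\<lambda>i. measure uniform_prod (?B i))"
    by (rule summable_comparison_test'[OF sm, of 0]) (use B in auto)
  have "measure uniform_prod (\<Union>i. ?B i) \<le> (\<Sum>i. measure uniform_prod (?B i))"
    using Bs smB by (intro U.P.finite_measure_subadditive_countably) auto
  also have "\<dots> \<le> suminf d"
    by (rule suminf_le[OF B smB sm])
  finally have "1 - suminf d \<le> measure uniform_prod (space uniform_prod - (\<Union>i. ?B i))"
    using Bs by (subst U.P.prob_compl) auto
  also have "\<dots> = measure uniform_prod {x \<in> carrier prod_grp. \<forall>i. P i (x i)}"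
  proof (rule U.P.finite_measure_eq_AE)
    show "AE x in uniform_prod. (x \<in> space uniform_prod - (\<Union>i. ?B i)) = (x \<in> {x \<in> carrier prod_grp. \<forall>i. P i (x i)})"
      using AE_carrier by eventually_elim (auto simp: space_uniform_prod)
    have "{x \<in> carrier prod_grp. \<forall>i. P i (x i)} = carrier prod_grp - (\<Union>i. ?B i)" by auto
    then show "{x \<in> carrier prod_grp. \<forall>i. P i (x i)} \<in> sets uniform_prod"
      using Bs carrier_sets by auto
  qed (use Bs in auto)
  also have "\<dots> = measure haar {x \<in> carrier prod_grp. \<forall>i. P i (x i)}"
    unfolding measure_def by (subst emeasure_haar) auto
  finally show ?thesis .
qed

end

section \<open>Signed shifts acting on vectors over a prime field\<close>

type_synonym signed_affine = "(int \<Rightarrow> int) \<times> (int \<Rightarrow> int) \<times> int"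

locale signed_shifts =
  fixes p :: nat
  assumes prime_p: "prime p" and p_gt_2: "2 < p"
begin

text \<open>Vectors and sign patterns indexed by \<open>\<int>/p\<close> are represented by periodic functions on the integers, so
that shifting the argument needs no reduction. The triple \<open>(v, f, c)\<close> stands for the affine map
that sends \<open>w\<close> to \<open>\<lambda>x. v x + f x * w (x + c)\<close>, and multiplication is composition of these maps.\<close>

definition residues :: "(int \<Rightarrow> int) set" where
  "residues = {v. \<forall>x. v (x mod int p) = v x \<and> v x \<in> {0..<int p}}"

definition signs :: "(int \<Rightarrow> int) set" where
  "signs = {f. (\<forall>x. f (x mod int p) = f x \<and> f x \<in> {1, -1}) \<and> (\<Prod>i<p. f (int i)) = 1}"

definition grp :: "signed_affine monoid" where
  "grp = \<lparr>carrier = residues \<times> signs \<times> {0..<int p},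
     monoid.mult = (\<lambda>(v, f, c) (v', f', c').
       (\<lambda>x. (v x + f x * v' (x + c)) mod int p, \<lambda>x. f x * f' (x + c), (c + c') mod int p)),
     one = (\<lambda>x. 0, \<lambda>x. 1, 0)\<rparr>"

lemma add_mult_mod_absorb: "(a + s * (t mod q)) mod q = (a + s * t) mod (q::int)"
  by (metis mod_add_right_eq mod_mult_right_eq)

lemma p_pos: "0 < int p" using p_gt_2 by simp

lemma periodicD:
  assumes "\<And>x. g (x mod int p) = g x" "a mod int p = b mod int p"
  shows "g a = g b"
  using assms by metis

lemma residuesD:
  assumes "v \<in> residues"
  shows "a mod int p = b mod int p \<Longrightarrow> v a = v b" "v x \<in> {0..<int p}" "v x mod int p = v x"
  using assms periodicD[of v a b] by (auto simp: residues_def)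

lemma signsD:
  assumes "f \<in> signs"
  shows "a mod int p = b mod int p \<Longrightarrow> f a = f b" "f x \<in> {1, -1}" "f x * f x = 1"
    "(\<Prod>i<p. f (int i)) = 1"
proof -
  show "f x \<in> {1, -1}" using assms by (auto simp: signs_def)
  then show "f x * f x = 1" by auto
qed (use assms periodicD[of f a b] in \<open>auto simp: signs_def\<close>)

text \<open>Since \<open>p\<close> is prime, \<open>x, x + c, x + 2 * c, \<dots>\<close> runs through all residues whenever \<open>c\<close> is nonzero modulo \<open>p\<close>.\<close>

lemma prod_along_progression:
  assumes per: "\<And>x. f (x mod int p) = f x" and c: "\<not> int p dvd c"
  shows "(\<Prod>i<p. f (x + int i * c)) = (\<Prod>i<p. f (int i) :: int)"
proof -
  define h where "h i = nat ((x + int i * c) mod int p)" for i :: nat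
  have h: "int (h i) = (x + int i * c) mod int p" for i
    using p_pos by (simp add: h_def)
  have "h i < p" for i
    using h[of i] p_pos by (metis of_nat_less_iff pos_mod_bound)
  then have sub: "h ` {..<p} \<subseteq> {..<p}" by auto
  have inj: "inj_on h {..<p}"
  proof (rule inj_onI)
    fix i j assume ij: "i \<in> {..<p}" "j \<in> {..<p}" "h i = h j"
    then have "(x + int i * c) mod int p = (x + int j * c) mod int p" using h by metis
    then have "int p dvd (int i - int j) * c"
      by (simp add: mod_eq_dvd_iff left_diff_distrib)
    then have "int p dvd int i - int j"
      using c prime_p by (simp add: prime_dvd_mult_iff)
    then show "i = j"
      using ij(1,2) zdvd_imp_le[of "int p" "\<bar>int i - int j\<bar>"] by (cases "i = j") auto
  qed
  have "(\<Prod>i<p. f (int i)) = (\<Prod>i\<in>h ` {..<p}. f (int i))"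
    using endo_inj_surj[OF _ sub inj] by simp
  also have "\<dots> = (\<Prod>i<p. f (int (h i)))"
    by (rule prod.reindex_cong[OF inj]) auto
  also have "\<dots> = (\<Prod>i<p. f (x + int i * c))"
    by (simp add: h per)
  finally show ?thesis ..
qed

lemma signs_shift:
  assumes "f \<in> signs"
  shows "(\<lambda>x. f (x + c)) \<in> signs"
proof -
  have "(\<Prod>i<p. f (int i + c)) = 1"
    using prod_along_progression[of f 1 c] assms p_gt_2 by (simp add: signs_def add.commute)
  moreover have "f (x mod int p + c) = f (x + c)" for x
    by (rule signsD(1)[OF assms]) (simp add: mod_simps)
  ultimately show ?thesis
    using assms by (auto simp: signs_def)
qed

lemma signs_mult:
  assumes "f \<in> signs" "f' \<in> signs"
  shows "(\<lambda>x. f x * f' x) \<in> signs"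
proof -
  have "f x * f' x \<in> {1, -1}" for x
    using signsD(2)[OF assms(1), of x] signsD(2)[OF assms(2), of x] by auto
  then show ?thesis
    using assms by (simp add: signs_def prod.distrib)
qed

lemma residues_mod:
  assumes "\<And>x. g (x mod int p) mod int p = g x mod int p"
  shows "(\<lambda>x. g x mod int p) \<in> residues"
  using assms p_pos by (simp add: residues_def)

lemma one_in: "(\<lambda>x. 0) \<in> residues" "(\<lambda>x. 1) \<in> signs"
  using p_pos by (auto simp: residues_def signs_def)

lemma grp_simps:
  "carrier grp = residues \<times> signs \<times> {0..<int p}"
  "\<one>\<^bsub>grp\<^esub> = (\<lambda>x. 0, \<lambda>x. 1, 0)"
  "(v, f, c) \<otimes>\<^bsub>grp\<^esub> (v', f', c') =
     (\<lambda>x. (v x + f x * v' (x + c)) mod int p, \<lambda>x. f x * f' (x + c), (c + c') mod int p)"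
  by (simp_all add: grp_def)

definition inverse_of :: "signed_affine \<Rightarrow> signed_affine" where
  "inverse_of = (\<lambda>(v, f, c). (\<lambda>x. (- (f (x - c) * v (x - c))) mod int p, \<lambda>x. f (x - c), (- c) mod int p))"

lemma mult_closed:
  assumes "a \<in> carrier grp" "b \<in> carrier grp"
  shows "a \<otimes>\<^bsub>grp\<^esub> b \<in> carrier grp"
proof -
  obtain v f c v' f' c' where ab: "a = (v, f, c)" "b = (v', f', c')"
    by (metis prod_cases3)
  have m: "v \<in> residues" "f \<in> signs" "v' \<in> residues" "f' \<in> signs"
    using assms by (auto simp: ab grp_simps)
  have "v (x mod int p) = v x" "f (x mod int p) = f x" "v' (x mod int p + c) = v' (x + c)" for x
    by (rule residuesD(1)[OF m(1)] signsD(1)[OF m(2)] residuesD(1)[OF m(3)], simp add: mod_simps)+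
  then have "(\<lambda>x. (v x + f x * v' (x + c)) mod int p) \<in> residues"
    by (intro residues_mod) simp
  moreover have "(\<lambda>x. f x * f' (x + c)) \<in> signs"
    by (intro signs_mult signs_shift m)
  ultimately show ?thesis
    using p_pos by (simp add: ab grp_simps)
qed

lemma inverse_closed:
  assumes "a \<in> carrier grp"
  shows "inverse_of a \<in> carrier grp"
proof -
  obtain v f c where a: "a = (v, f, c)" by (metis prod_cases3)
  have m: "v \<in> residues" "f \<in> signs"
    using assms by (auto simp: a grp_simps)
  have "v (x mod int p - c) = v (x - c)" "f (x mod int p - c) = f (x - c)" for x
    by (rule residuesD(1)[OF m(1)] signsD(1)[OF m(2)], simp add: mod_simps)+
  then have "(\<lambda>x. (- (f (x - c) * v (x - c))) mod int p) \<in> residues"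
    by (intro residues_mod) simp
  moreover have "(\<lambda>x. f (x - c)) \<in> signs"
    using signs_shift[OF m(2), of "- c"] by simp
  ultimately show ?thesis
    using p_pos by (simp add: a grp_simps inverse_of_def)
qed

lemma inverse_mult:
  assumes "a \<in> carrier grp"
  shows "inverse_of a \<otimes>\<^bsub>grp\<^esub> a = \<one>\<^bsub>grp\<^esub>"
proof -
  obtain v f c where a: "a = (v, f, c)" by (metis prod_cases3)
  have m: "v \<in> residues" "f \<in> signs"
    using assms by (auto simp: a grp_simps)
  have "v (x + - c mod int p) = v (x - c)" "f (x + - c mod int p) = f (x - c)" for x
    by (rule residuesD(1)[OF m(1)] signsD(1)[OF m(2)], simp add: mod_simps)+
  then show ?thesis
    by (simp add: a grp_simps inverse_of_def signsD(3)[OF m(2)] mod_simps)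
qed

lemma mult_assoc:
  assumes "a \<in> carrier grp" "b \<in> carrier grp" "d \<in> carrier grp"
  shows "(a \<otimes>\<^bsub>grp\<^esub> b) \<otimes>\<^bsub>grp\<^esub> d = a \<otimes>\<^bsub>grp\<^esub> (b \<otimes>\<^bsub>grp\<^esub> d)"
proof -
  obtain v f c v' f' c' v'' f'' c'' where abd: "a = (v, f, c)" "b = (v', f', c')" "d = (v'', f'', c'')"
    by (metis prod_cases3)
  have m: "v'' \<in> residues" "f'' \<in> signs"
    using assms by (auto simp: abd grp_simps)
  have "v'' (x + (c + c') mod int p) = v'' (x + c + c')" "f'' (x + (c + c') mod int p) = f'' (x + c + c')" for x
    by (rule residuesD(1)[OF m(1)] signsD(1)[OF m(2)], simp add: mod_simps add.assoc)+
  then show ?thesis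
    by (simp add: abd grp_simps add_mult_mod_absorb mod_simps) (simp add: algebra_simps)
qed

lemma group_grp: "group grp"
proof (rule groupI)
  show "\<one>\<^bsub>grp\<^esub> \<in> carrier grp"
    using one_in p_pos by (simp add: grp_simps)
  show "\<one>\<^bsub>grp\<^esub> \<otimes>\<^bsub>grp\<^esub> a = a" if "a \<in> carrier grp" for a
    using that residuesD(3) by (cases a) (auto simp: grp_simps fun_eq_iff)
  show "\<exists>b\<in>carrier grp. b \<otimes>\<^bsub>grp\<^esub> a = \<one>\<^bsub>grp\<^esub>" if "a \<in> carrier grp" for a
    using inverse_closed inverse_mult that by blast
qed (simp_all add: mult_closed mult_assoc)

sublocale group grp by (rule group_grp)

lemma inv_grp: "a \<in> carrier grp \<Longrightarrow> inv\<^bsub>grp\<^esub> a = inverse_of a"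
  by (intro inv_equality inverse_mult inverse_closed)

lemma finite_residues: "finite residues"
proof (rule finite_subset)
  show "residues \<subseteq> (\<lambda>g x. g (x mod int p)) ` ({0..<int p} \<rightarrow>\<^sub>E {0..<int p})"
  proof
    fix v assume v: "v \<in> residues"
    show "v \<in> (\<lambda>g x. g (x mod int p)) ` ({0..<int p} \<rightarrow>\<^sub>E {0..<int p})"
      by (rule image_eqI[of _ _ "restrict v {0..<int p}"])
        (use v p_pos in \<open>auto simp: residues_def fun_eq_iff\<close>)
  qed
qed (intro finite_imageI finite_PiE, auto)

lemma finite_signs: "finite signs"
proof (rule finite_subset)
  show "signs \<subseteq> (\<lambda>g x. g (x mod int p)) ` ({0..<int p} \<rightarrow>\<^sub>E {1, -1})"
  proof
    fix v assume v: "v \<in> signs"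
    show "v \<in> (\<lambda>g x. g (x mod int p)) ` ({0..<int p} \<rightarrow>\<^sub>E {1, -1})"
      by (rule image_eqI[of _ _ "restrict v {0..<int p}"])
        (use v p_pos in \<open>auto simp: signs_def fun_eq_iff\<close>)
  qed
qed (intro finite_imageI finite_PiE, auto)

lemma finite_grp: "finite (carrier grp)"
  by (simp add: grp_simps finite_residues finite_signs)

text \<open>The shift amount and, for elements without shift, the sign pattern are homomorphisms to abelian groups;
what remains is the abelian group of translations.\<close>

lemma derived_grp: "(derived grp ^^ 3) (carrier grp) = {\<one>\<^bsub>grp\<^esub>}"
proof -
  define K1 where "K1 = {(v, f, c) \<in> carrier grp. c = 0}"
  define K2 where "K2 = {(v, f, c) \<in> carrier grp. f = (\<lambda>x. 1) \<and> c = 0}"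
  have K1: "subgroup K1 grp"
  proof (rule subgroup.intro)
    show "a \<otimes>\<^bsub>grp\<^esub> b \<in> K1" if "a \<in> K1" "b \<in> K1" for a b
      using that m_closed[of a b] by (auto simp: K1_def grp_simps(3) simp del: m_closed)
    show "inv\<^bsub>grp\<^esub> a \<in> K1" if "a \<in> K1" for a
      using that inv_closed[of a] by (auto simp: K1_def inv_grp inverse_of_def simp del: inv_closed)
    show "\<one>\<^bsub>grp\<^esub> \<in> K1" using one_closed by (auto simp: K1_def grp_simps(2))
  qed (auto simp: K1_def)
  have K2: "subgroup K2 grp"
  proof (rule subgroup.intro)
    show "a \<otimes>\<^bsub>grp\<^esub> b \<in> K2" if "a \<in> K2" "b \<in> K2" for a b
      using that m_closed[of a b] by (auto simp: K2_def grp_simps(3) simp del: m_closed)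
    show "inv\<^bsub>grp\<^esub> a \<in> K2" if "a \<in> K2" for a
      using that inv_closed[of a] by (auto simp: K2_def inv_grp inverse_of_def simp del: inv_closed)
    show "\<one>\<^bsub>grp\<^esub> \<in> K2" using one_closed by (auto simp: K2_def grp_simps(2))
  qed (auto simp: K2_def)
  have comm: "a \<otimes>\<^bsub>grp\<^esub> b \<otimes>\<^bsub>grp\<^esub> inv\<^bsub>grp\<^esub> a \<otimes>\<^bsub>grp\<^esub> inv\<^bsub>grp\<^esub> b \<in> carrier grp"
    if "a \<in> carrier grp" "b \<in> carrier grp" for a b using that by simp
  have "a \<otimes>\<^bsub>grp\<^esub> b \<otimes>\<^bsub>grp\<^esub> inv\<^bsub>grp\<^esub> a \<otimes>\<^bsub>grp\<^esub> inv\<^bsub>grp\<^esub> b \<in> K1"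
    if ab: "a \<in> carrier grp" "b \<in> carrier grp" for a b
  proof -
    obtain v f c v' f' c' where e: "a = (v, f, c)" "b = (v', f', c')" by (metis prod_cases3)
    show ?thesis
      using comm[OF ab] ab unfolding K1_def e
      by (simp add: inv_grp inverse_of_def grp_simps(3) mod_simps)
  qed
  then have d1: "derived grp (carrier grp) \<subseteq> K1"
    unfolding derived_def by (intro generate_subgroup_incl[OF _ K1]) auto
  have "a \<otimes>\<^bsub>grp\<^esub> b \<otimes>\<^bsub>grp\<^esub> inv\<^bsub>grp\<^esub> a \<otimes>\<^bsub>grp\<^esub> inv\<^bsub>grp\<^esub> b \<in> K2"
    if ab: "a \<in> K1" "b \<in> K1" for a b
  proof -
    obtain v f v' f' where e: "a = (v, f, 0)" "b = (v', f', 0)"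
      using ab by (auto simp: K1_def)
    have abc: "a \<in> carrier grp" "b \<in> carrier grp" using ab by (auto simp: K1_def)
    have "f \<in> signs" "f' \<in> signs" using abc by (auto simp: e grp_simps)
    then have "f x * f' x * f x * f' x = 1" for x
      using signsD(3)[of f x] signsD(3)[of f' x] by (metis mult.assoc mult.commute mult_1)
    then show ?thesis
      using comm[OF abc] abc unfolding K2_def e
      by (simp add: inv_grp inverse_of_def grp_simps(3))
  qed
  then have d2: "derived grp K1 \<subseteq> K2"
    unfolding derived_def by (intro generate_subgroup_incl[OF _ K2]) auto
  have "a \<otimes>\<^bsub>grp\<^esub> b \<otimes>\<^bsub>grp\<^esub> inv\<^bsub>grp\<^esub> a \<otimes>\<^bsub>grp\<^esub> inv\<^bsub>grp\<^esub> b \<in> {\<one>\<^bsub>grp\<^esub>}"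
    if ab: "a \<in> K2" "b \<in> K2" for a b
  proof -
    obtain v v' where e: "a = (v, \<lambda>x. 1, 0)" "b = (v', \<lambda>x. 1, 0)"
      using ab by (auto simp: K2_def)
    have abc: "a \<in> carrier grp" "b \<in> carrier grp" using ab by (auto simp: K2_def)
    then show ?thesis unfolding e
      by (simp add: inv_grp inverse_of_def grp_simps(2,3) mod_simps)
  qed
  then have d3: "derived grp K2 \<subseteq> {\<one>\<^bsub>grp\<^esub>}"
    unfolding derived_def by (intro generate_subgroup_incl[OF _ triv_subgroup]) blast
  have "(derived grp ^^ 3) (carrier grp) \<subseteq> derived grp (derived grp K1)"
    using mono_derived[OF mono_derived[OF d1]] by (simp add: numeral_3_eq_3)
  also have "\<dots> \<subseteq> {\<one>\<^bsub>grp\<^esub>}" using mono_derived[OF d2] d3 by blast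
  finally show ?thesis
    using subgroup.one_closed[OF exp_of_derived_is_subgroup[OF subgroup_self]] by blast
qed

text \<open>Translations form an abelian normal subgroup on which \<open>(w', s, k)\<close> acts through its linear part alone.\<close>

lemma commutator_translation:
  assumes a: "(w, \<lambda>x. 1, 0) \<in> carrier grp" and b: "(w', s, k) \<in> carrier grp"
  shows "commutator grp (w, \<lambda>x. 1, 0) (w', s, k) = (\<lambda>x. (w x - s x * w (x + k)) mod int p, \<lambda>x. 1, 0)"
proof -
  have m: "w \<in> residues" "w' \<in> residues" "s \<in> signs" using a b by (auto simp: grp_simps)
  have k: "0 \<le> k" "k < int p" using b by (auto simp: grp_simps)
  have "s x * s x = 1" for x by (rule signsD(3)[OF m(3)])
  then have s: "s x * (s x * t) = t" for x t by (metis mult.assoc mult_1)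
  have "commutator grp (w, \<lambda>x. 1, 0) (w', s, k) =
    (\<lambda>x. (w x + w' x - s x * w (x + k) - w' x) mod int p, \<lambda>x. s x * s x, 0)"
    using a b k
    by (simp add: commutator_def inv_grp inverse_of_def grp_simps(3) add_mult_mod_absorb mod_simps)
      (simp add: s algebra_simps)
  then show ?thesis using signsD(3)[OF m(3)] by simp
qed

definition gen :: signed_affine where
  "gen = (\<lambda>x. 1, \<lambda>x. 1, 0)"

lemma gen_in: "gen \<in> carrier grp"
  using p_gt_2 one_in by (simp add: gen_def grp_simps residues_def)

lemma gen_pow: "gen [^]\<^bsub>grp\<^esub> n = (\<lambda>x. int n mod int p, \<lambda>x. 1, 0)"
  by (induction n) (simp_all add: gen_def grp_simps mod_simps add.commute)

text \<open>A sign pattern with \<open>-1\<close> at 0 doubles the coordinate 0 of a translation under the commutator,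
and 2 is invertible modulo \<open>p\<close>.\<close>

lemma gen_pow_not_hypercentral:
  assumes n: "0 < n" "n < p"
  shows "gen [^]\<^bsub>grp\<^esub> n \<notin> finite_hypercenter grp"
proof
  \<comment> \<open>The second sign, at 1, makes the product of all signs equal to 1.\<close>
  define s :: "int \<Rightarrow> int" where "s x = (if x mod int p \<in> {0, 1} then -1 else 1)" for x
  have "(\<Prod>i<p. s (int i)) = (\<Prod>i\<in>{..<p} - {0, 1}. s (int i)) * (\<Prod>i\<in>{0, 1}. s (int i))"
    using p_gt_2 by (intro prod.subset_diff) auto
  also have "\<dots> = 1"
    using p_gt_2 by (subst prod.neutral) (auto simp: s_def)
  finally have "s \<in> signs"
    by (auto simp: signs_def s_def)
  then have y: "(\<lambda>x. 0, s, 0) \<in> carrier grp" (is "?y \<in> _")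
    using one_in p_pos by (simp add: grp_simps)
  have iter: "iterated_commutator grp (w, \<lambda>x. 1, 0) (replicate m ?y) \<noteq> \<one>\<^bsub>grp\<^esub>"
    if "(w, \<lambda>x. 1, 0) \<in> carrier grp" "\<not> int p dvd w 0" for w m
    using that
  proof (induction m arbitrary: w)
    case 0
    then show ?case by (auto simp: grp_simps)
  next
    case (Suc m)
    let ?w = "\<lambda>x. (w x - s x * w (x + 0)) mod int p"
    have c: "commutator grp (w, \<lambda>x. 1, 0) ?y = (?w, \<lambda>x. 1, 0)"
      by (rule commutator_translation[OF Suc.prems(1) y])
    have "(?w, \<lambda>x. 1, 0) \<in> carrier grp"
      using commutator_closed[OF Suc.prems(1) y] c by metis
    moreover have "\<not> int p dvd ?w 0"
    proof -
      have "\<not> int p dvd 2 * w 0"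
        using Suc.prems(2) prime_p p_gt_2 by (auto simp: prime_dvd_mult_iff dest: zdvd_imp_le)
      then show ?thesis by (simp add: s_def dvd_mod_iff)
    qed
    ultimately have "iterated_commutator grp (?w, \<lambda>x. 1, 0) (replicate m ?y) \<noteq> \<one>\<^bsub>grp\<^esub>"
      by (rule Suc.IH)
    then show ?case using c by simp
  qed
  assume "gen [^]\<^bsub>grp\<^esub> n \<in> finite_hypercenter grp"
  then obtain m where "gen [^]\<^bsub>grp\<^esub> n \<in> upper_central grp m"
    by (auto simp: finite_hypercenter_def)
  then have "iterated_commutator grp (gen [^]\<^bsub>grp\<^esub> n) (replicate m ?y) = \<one>\<^bsub>grp\<^esub>"
    using y by (simp add: upper_central_iff in_lists_conv_set)
  moreover have "\<not> int p dvd int n mod int p"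
    using n by (auto dest: zdvd_imp_le)
  ultimately show False
    using iter[of "\<lambda>x. int n mod int p" m] nat_pow_closed[OF gen_in, of n] unfolding gen_pow by blast
qed

end

section \<open>Unipotency of signed cyclic shifts\<close>

text \<open>This is the linear part \<open>M\<close> of the affine map \<open>(v, f, c)\<close>, on arbitrary integer-valued functions; the
operator \<open>twisted_difference f c\<close> is \<open>M - 1\<close>.\<close>

definition twist :: "(int \<Rightarrow> int) \<Rightarrow> int \<Rightarrow> (int \<Rightarrow> int) \<Rightarrow> int \<Rightarrow> int" where
  "twist f c u = (\<lambda>x. f x * u (x + c))"

definition twisted_difference :: "(int \<Rightarrow> int) \<Rightarrow> int \<Rightarrow> (int \<Rightarrow> int) \<Rightarrow> int \<Rightarrow> int" where
  "twisted_difference f c u = (\<lambda>x. twist f c u x - u x)"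

lemma twist_power_apply:
  "(twist f c ^^ n) u x = (\<Prod>i<n. f (x + int i * c)) * u (x + int n * c)"
proof (induction n arbitrary: x)
  case (Suc n)
  have "(twist f c ^^ Suc n) u x = f x * (twist f c ^^ n) u (x + c)"
    by (simp add: twist_def)
  also have "\<dots> = f x * (\<Prod>i<n. f (x + int (Suc i) * c)) * u (x + int (Suc n) * c)"
    by (simp add: Suc.IH algebra_simps)
  also have "f x * (\<Prod>i<n. f (x + int (Suc i) * c)) = (\<Prod>i<Suc n. f (x + int i * c))"
    by (subst prod.lessThan_Suc_shift) simp
  finally show ?case .
qed simp

lemma twist_power_add:
  "(twist f c ^^ n) (\<lambda>x. u x + v x) = (\<lambda>x. (twist f c ^^ n) u x + (twist f c ^^ n) v x)"
  by (simp add: twist_power_apply fun_eq_iff algebra_simps)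

lemma twisted_difference_power_diff:
  "(twisted_difference f c ^^ n) (\<lambda>x. u x - v x) =
     (\<lambda>x. (twisted_difference f c ^^ n) u x - (twisted_difference f c ^^ n) v x)"
proof -
  have "twisted_difference f c (\<lambda>x. u x - v x) = (\<lambda>x. twisted_difference f c u x - twisted_difference f c v x)" for u v
    by (simp add: twisted_difference_def twist_def fun_eq_iff algebra_simps)
  then show ?thesis by (induction n) simp_all
qed

lemma twisted_difference_twist_power:
  "(twisted_difference f c ^^ m) ((twist f c ^^ n) u) = (twist f c ^^ n) ((twisted_difference f c ^^ m) u)"
proof -
  have 1: "twisted_difference f c (twist f c u) = twist f c (twisted_difference f c u)" for u
    by (simp add: twisted_difference_def twist_def fun_eq_iff algebra_simps)
  have 2: "twisted_difference f c ((twist f c ^^ n) u) = (twist f c ^^ n) (twisted_difference f c u)" for u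
    by (induction n) (simp_all add: 1)
  show ?thesis by (induction m) (simp_all add: 2)
qed

lemma twisted_difference_power_dvd:
  assumes "\<And>x. q dvd u x"
  shows "q dvd (twisted_difference f c ^^ n) u x"
  using assms by (induction n arbitrary: x) (simp_all add: twisted_difference_def twist_def)

text \<open>This is the binomial theorem for \<open>M = 1 + (M - 1)\<close>. Expanding the power of \<open>M\<close>, and not that of \<open>M - 1\<close>, avoids alternating signs.\<close>

lemma twist_power_binomial:
  "(twist f c ^^ n) u x = (\<Sum>i\<le>n. int (n choose i) * (twisted_difference f c ^^ i) u x)"
proof (induction n arbitrary: u)
  case (Suc n)
  let ?D = "\<lambda>i. (twisted_difference f c ^^ i) u x"
  have "twist f c u = (\<lambda>x. u x + twisted_difference f c u x)"
    by (simp add: twisted_difference_def)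
  then have "(twist f c ^^ Suc n) u x = (twist f c ^^ n) u x + (twist f c ^^ n) (twisted_difference f c u) x"
    by (simp only: funpow_Suc_right o_def twist_power_add)
  also have "\<dots> = (\<Sum>i\<le>n. int (n choose i) * ?D i) + (\<Sum>i\<le>n. int (n choose i) * ?D (Suc i))"
    by (simp only: Suc.IH funpow_Suc_right o_def)
  also have "(\<Sum>i\<le>n. int (n choose i) * ?D i) = (\<Sum>i\<le>Suc n. int (n choose i) * ?D i)"
    by simp
  also have "\<dots> = ?D 0 + (\<Sum>i\<le>n. int (n choose Suc i) * ?D (Suc i))"
    by (subst sum.atMost_Suc_shift) simp
  also have "?D 0 + (\<Sum>i\<le>n. int (n choose Suc i) * ?D (Suc i)) + (\<Sum>i\<le>n. int (n choose i) * ?D (Suc i)) =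
      (\<Sum>i\<le>Suc n. int (Suc n choose i) * ?D i)"
    by (subst sum.atMost_Suc_shift) (simp add: sum.distrib distrib_right)
  finally show ?case .
qed simp

context signed_shifts
begin

abbreviation periodic :: "(int \<Rightarrow> int) \<Rightarrow> bool" where
  "periodic u \<equiv> (\<forall>x. u (x mod int p) = u x)"

lemma periodic_twist_power:
  assumes f: "f \<in> signs" and u: "periodic u"
  shows "periodic ((twist f c ^^ n) u)"
proof
  fix x
  have "f (x mod int p + int i * c) = f (x + int i * c)" for i
    by (rule signsD(1)[OF f]) (simp add: mod_simps)
  moreover have "u (x mod int p + int n * c) = u (x + int n * c)"
    by (rule periodicD) (use u in \<open>simp_all add: mod_simps\<close>)
  ultimately show "(twist f c ^^ n) u (x mod int p) = (twist f c ^^ n) u x"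
    by (simp add: twist_power_apply)
qed

text \<open>After \<open>p\<close> steps the shift returns to its start, and the signs met on the way are all signs, each once.\<close>

lemma twist_power_p:
  assumes f: "f \<in> signs" and u: "periodic u" and c: "\<not> int p dvd c"
  shows "(twist f c ^^ p) u = u"
proof
  fix x
  have "(\<Prod>i<p. f (x + int i * c)) = 1"
    using prod_along_progression[OF _ c, of f x] f by (simp add: signs_def)
  moreover have "u (x + int p * c) = u x"
    by (rule periodicD) (use u in simp_all)
  ultimately show "(twist f c ^^ p) u x = u x"
    by (simp add: twist_power_apply)
qed

lemma twist_power_p_mult:
  assumes "f \<in> signs" "periodic u" "\<not> int p dvd c"
  shows "(twist f c ^^ (j * p)) u = u"
  by (induction j) (simp_all add: funpow_add twist_power_p[OF assms])

text \<open>The inner binomial coefficients are divisible by \<open>p\<close>, so \<open>M ^ p = 1\<close> leaves \<open>(M - 1) ^ p = 0\<close> modulo \<open>p\<close>.\<close>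

lemma twisted_difference_unipotent:
  assumes "f \<in> signs" "periodic u" "\<not> int p dvd c"
  shows "int p dvd (twisted_difference f c ^^ p) u x"
proof -
  let ?D = "\<lambda>i. (twisted_difference f c ^^ i) u x"
  have "u x = (\<Sum>i\<le>p. int (p choose i) * ?D i)"
    using twist_power_binomial[of p f c u x] twist_power_p[OF assms] by simp
  also have "{..p} = insert 0 (insert p {1..<p})"
    using p_gt_2 by auto
  also have "(\<Sum>i\<in>\<dots>. int (p choose i) * ?D i) = u x + (?D p + (\<Sum>i\<in>{1..<p}. int (p choose i) * ?D i))"
    using p_gt_2 by (subst sum.insert; simp)+
  finally have "?D p = - (\<Sum>i\<in>{1..<p}. int (p choose i) * ?D i)"
    by simp
  moreover have "int p dvd (\<Sum>i\<in>{1..<p}. int (p choose i) * ?D i)"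
  proof (rule dvd_sum)
    fix i assume "i \<in> {1..<p}"
    then have "p dvd (p choose i)"
      using prime_p by (intro dvd_choose_prime) auto
    then show "int p dvd int (p choose i) * ?D i"
      by (simp add: dvd_mult2)
  qed
  ultimately show ?thesis by simp
qed

text \<open>The elements whose linear part is a power of \<open>M\<close>. Only periodic functions are compared, because
the shift amount \<open>k\<close> is reduced modulo \<open>p\<close>.\<close>

definition twist_subgroup :: "(int \<Rightarrow> int) \<Rightarrow> int \<Rightarrow> signed_affine set" where
  "twist_subgroup f c =
     {(w, s, k) \<in> carrier grp. \<exists>j. \<forall>u. periodic u \<longrightarrow> twist s k u = (twist f c ^^ j) u}"

lemma twist_subgroup_is_subgroup:
  assumes f: "f \<in> signs" and c: "\<not> int p dvd c"
  shows "subgroup (twist_subgroup f c) grp"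
proof (rule subgroup.intro)
  show "\<one>\<^bsub>grp\<^esub> \<in> twist_subgroup f c"
  proof -
    have "twist (\<lambda>x. 1) 0 u = (twist f c ^^ 0) u" for u by (simp add: twist_def)
    then show ?thesis
      using one_closed unfolding twist_subgroup_def grp_simps(2) by blast
  qed
  fix a assume a: "a \<in> twist_subgroup f c"
  then obtain w s k j where ae: "a = (w, s, k)" and ac: "(w, s, k) \<in> carrier grp"
    and j: "\<And>u. periodic u \<Longrightarrow> twist s k u = (twist f c ^^ j) u"
    by (auto simp: twist_subgroup_def)
  have s: "s \<in> signs" using ac by (simp add: grp_simps)
  show "inv\<^bsub>grp\<^esub> a \<in> twist_subgroup f c"
  proof -
    \<comment> \<open>As \<open>M ^ p = 1\<close>, the inverse of \<open>M ^ j\<close> is \<open>M ^ (j * (p - 1))\<close>.\<close>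
    have "twist (\<lambda>x. s (x - k)) (- k mod int p) u = (twist f c ^^ (j * (p - 1))) u" if u: "periodic u" for u
    proof
      fix x
      let ?u = "(twist f c ^^ (j * (p - 1))) u"
      have "twist s k ?u = (twist f c ^^ (j + j * (p - 1))) u"
        using j[OF periodic_twist_power[OF f u]] by (simp add: funpow_add)
      also have "j + j * (p - 1) = j * p" using p_gt_2 by (cases p) auto
      finally have "twist s k ?u = u"
        using twist_power_p_mult[OF f u c] by simp
      then have "u (x - k) = s (x - k) * ?u x"
        by (metis twist_def diff_add_cancel)
      moreover have "u (x + - k mod int p) = u (x - k)"
        by (rule periodicD) (use u in \<open>simp_all add: mod_simps\<close>)
      ultimately have "twist (\<lambda>x. s (x - k)) (- k mod int p) u x = s (x - k) * s (x - k) * ?u x"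
        by (simp add: twist_def)
      then show "twist (\<lambda>x. s (x - k)) (- k mod int p) u x = ?u x"
        using signsD(3)[OF s, of "x - k"] by simp
    qed
    then show ?thesis
      using inv_closed[OF ac] inv_grp[OF ac] unfolding ae twist_subgroup_def inverse_of_def by auto
  qed
  fix b assume b: "b \<in> twist_subgroup f c"
  then obtain w' s' k' j' where be: "b = (w', s', k')" and bc: "(w', s', k') \<in> carrier grp"
    and j': "\<And>u. periodic u \<Longrightarrow> twist s' k' u = (twist f c ^^ j') u"
    by (auto simp: twist_subgroup_def)
  show "a \<otimes>\<^bsub>grp\<^esub> b \<in> twist_subgroup f c"
  proof -
    have "twist (\<lambda>x. s x * s' (x + k)) ((k + k') mod int p) u = (twist f c ^^ (j + j')) u" if u: "periodic u" for u
    proof -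
      have "u (x + (k + k') mod int p) = u (x + k + k')" for x
        by (rule periodicD) (use u in \<open>simp_all add: mod_simps add.assoc\<close>)
      then have "twist (\<lambda>x. s x * s' (x + k)) ((k + k') mod int p) u = twist s k (twist s' k' u)"
        by (simp add: twist_def mult.assoc)
      then show ?thesis
        using j[OF periodic_twist_power[OF f u]] j'[OF u] by (simp add: funpow_add)
    qed
    then show ?thesis
      using m_closed[OF ac bc] unfolding ae be twist_subgroup_def grp_simps(3) by blast
  qed
qed (auto simp: twist_subgroup_def)

text \<open>Powers of \<open>M\<close> commute, so \<open>a \<otimes> b\<close> and \<open>b \<otimes> a\<close> have the same linear part and differ by a translation.\<close>

lemma twist_subgroup_commutator:
  assumes f: "f \<in> signs" and a: "a \<in> twist_subgroup f c" and b: "b \<in> twist_subgroup f c"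
  obtains w where "commutator grp a b = (w, \<lambda>x. 1, 0)" "(w, \<lambda>x. 1, 0) \<in> carrier grp"
proof -
  obtain w s k j where ae: "a = (w, s, k)" and ac: "a \<in> carrier grp"
    and j: "\<And>u. periodic u \<Longrightarrow> twist s k u = (twist f c ^^ j) u"
    using a by (auto simp: twist_subgroup_def)
  obtain w' s' k' j' where be: "b = (w', s', k')" and bc: "b \<in> carrier grp"
    and j': "\<And>u. periodic u \<Longrightarrow> twist s' k' u = (twist f c ^^ j') u"
    using b by (auto simp: twist_subgroup_def)
  have s: "periodic s" "periodic s'" using ac bc by (auto simp: ae be grp_simps signs_def)
  \<comment> \<open>The sign pattern is recovered from the action on the constant vector 1.\<close>
  have sM: "s = (twist f c ^^ j) (\<lambda>x. 1)" "s' = (twist f c ^^ j') (\<lambda>x. 1)"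
    using j[of "\<lambda>x. 1"] j'[of "\<lambda>x. 1"] by (simp_all add: twist_def)
  have "twist s k s' = twist s' k' s"
    unfolding j[OF s(2)] j'[OF s(1)]
    by (simp only: sM funpow_add[symmetric, THEN fun_cong, unfolded o_def] add.commute)
  then have ss: "(\<lambda>x. s x * s' (x + k)) = (\<lambda>x. s' x * s (x + k'))" by (simp add: twist_def)
  define S where "S = (\<lambda>x. s x * s' (x + k))"
  define K where "K = (k + k') mod int p"
  obtain v1 v2 where ab: "a \<otimes>\<^bsub>grp\<^esub> b = (v1, S, K)" and ba: "b \<otimes>\<^bsub>grp\<^esub> a = (v2, S, K)"
    unfolding ae be grp_simps(3) S_def K_def using ss by (simp add: add.commute)
  have "S \<in> signs" using m_closed[OF ac bc] unfolding ab by (simp add: grp_simps)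
  then have SS: "S x * S x = 1" for x by (rule signsD(3))
  have "commutator grp a b = (a \<otimes>\<^bsub>grp\<^esub> b) \<otimes>\<^bsub>grp\<^esub> inv\<^bsub>grp\<^esub> (b \<otimes>\<^bsub>grp\<^esub> a)"
    using ac bc by (simp add: commutator_def inv_mult_group m_assoc)
  also have "\<dots> = (v1, S, K) \<otimes>\<^bsub>grp\<^esub> inverse_of (v2, S, K)"
    using inv_grp[OF m_closed[OF bc ac]] by (simp add: ab ba)
  finally obtain v where v: "commutator grp a b = (v, \<lambda>x. 1, 0)"
    by (simp add: inverse_of_def grp_simps(3) SS mod_simps)
  show thesis
    using that[OF v] commutator_closed[OF ac bc] v by simp
qed

text \<open>The commutator of a translation \<open>w\<close> with an element acting as \<open>M ^ j\<close> is the translation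
\<open>w - M ^ j w\<close>, and \<open>M - 1\<close> divides \<open>1 - M ^ j\<close>. So each commutator lowers by one the power of
\<open>M - 1\<close> that is needed to annihilate the translation modulo \<open>p\<close>.\<close>

lemma twist_subgroup_kills_translations:
  assumes f: "f \<in> signs" and w: "(w, \<lambda>x. 1, 0) \<in> carrier grp"
    and D: "\<And>x. int p dvd (twisted_difference f c ^^ m) w x"
    and ys: "ys \<in> lists (twist_subgroup f c)" "length ys = m"
  shows "iterated_commutator grp (w, \<lambda>x. 1, 0) ys = \<one>\<^bsub>grp\<^esub>"
  using w D ys
proof (induction m arbitrary: w ys)
  case 0
  have "w x = 0" for x
  proof -
    have "w \<in> residues" using 0(1) by (simp add: grp_simps)
    from residuesD(2)[OF this, of x] have "w x \<in> {0..<int p}" .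
    moreover have "int p dvd w x" using 0(2)[of x] by simp
    ultimately show ?thesis by (auto dest: zdvd_imp_le)
  qed
  then show ?case using 0 by (auto simp: grp_simps)
next
  case (Suc m)
  then obtain y zs where ys: "ys = y # zs" "y \<in> twist_subgroup f c" "zs \<in> lists (twist_subgroup f c)" "length zs = m"
    by (cases ys) auto
  obtain w' s k j where y: "y = (w', s, k)" "(w', s, k) \<in> carrier grp"
    and j: "\<And>u. periodic u \<Longrightarrow> twist s k u = (twist f c ^^ j) u"
    using ys(2) by (auto simp: twist_subgroup_def)
  let ?D = "twisted_difference f c" and ?M = "twist f c"
  let ?g = "\<lambda>x. w x - (?M ^^ j) w x"
  let ?w = "\<lambda>x. ?g x mod int p"
  have "periodic w" using Suc.prems(1) by (simp add: grp_simps residues_def)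
  then have "s x * w (x + k) = (?M ^^ j) w x" for x
    using j[of w] by (simp add: twist_def fun_eq_iff)
  then have com: "commutator grp (w, \<lambda>x. 1, 0) y = (?w, \<lambda>x. 1, 0)"
    using commutator_translation[OF Suc.prems(1) y(2)] by (simp add: y)
  have in_grp: "(?w, \<lambda>x. 1, 0) \<in> carrier grp"
    using commutator_closed[OF Suc.prems(1) y(2)] com y by simp
  \<comment> \<open>The difference \<open>w - M ^ i w\<close> telescopes into terms \<open>- M ^ l (M - 1) w\<close>, and \<open>M\<close> commutes with \<open>M - 1\<close>.\<close>
  have D_diff: "int p dvd (?D ^^ m) (\<lambda>x. w x - (?M ^^ i) w x) x" for i x
  proof (induction i)
    case 0
    then show ?case by (simp add: twisted_difference_power_dvd)
  next
    case (Suc i)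
    have "(?D ^^ m) (\<lambda>x. w x - (?M ^^ Suc i) w x) x =
        (?D ^^ m) (\<lambda>x. w x - (?M ^^ i) w x) x - (?D ^^ m) (\<lambda>x. (?M ^^ Suc i) w x - (?M ^^ i) w x) x"
      by (simp flip: twisted_difference_power_diff[THEN fun_cong])
    also have "(\<lambda>x. (?M ^^ Suc i) w x - (?M ^^ i) w x) = ?D ((?M ^^ i) w)"
      by (simp add: twisted_difference_def)
    also have "(?D ^^ m) (?D ((?M ^^ i) w)) = (?M ^^ i) ((?D ^^ Suc m) w)"
      using twisted_difference_twist_power[of "Suc m" f c i w] by (simp only: funpow_Suc_right o_def)
    finally show ?case
      using Suc.IH Suc.prems \<open>\<And>x. int p dvd (?D ^^ Suc m) w x\<close>
      by (simp add: twist_power_apply)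
  qed
  have D': "int p dvd (?D ^^ m) ?w x" for x
  proof -
    have "int p dvd (?D ^^ m) (\<lambda>x. ?g x - ?w x) x"
      by (rule twisted_difference_power_dvd) (simp add: minus_mod_eq_mult_div)
    then have "int p dvd (?D ^^ m) ?g x - (?D ^^ m) ?w x"
      by (simp only: twisted_difference_power_diff[of m f c ?g ?w])
    from dvd_diff[OF D_diff[of j x] this] show ?thesis by (simp only: diff_diff_eq2 add_diff_cancel_left')
  qed
  have "iterated_commutator grp (?w, \<lambda>x. 1, 0) zs = \<one>\<^bsub>grp\<^esub>"
    by (rule Suc.IH[OF in_grp D' ys(3,4)])
  then show ?case by (simp add: ys(1) com)
qed

lemma nilpotent_twist_subgroup:
  assumes f: "f \<in> signs" and c: "\<not> int p dvd c"
  shows "nilpotent_on grp (twist_subgroup f c)"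
  unfolding nilpotent_on_def
\<comment> \<open>One commutator to reach the translations, then \<open>p\<close> more to annihilate them.\<close>
proof (intro exI[of _ "Suc p"] ballI impI)
  fix a ys assume a: "a \<in> twist_subgroup f c" and ys: "ys \<in> lists (twist_subgroup f c)" "length ys = Suc p"
  obtain y zs where y: "ys = y # zs" "y \<in> twist_subgroup f c" "zs \<in> lists (twist_subgroup f c)" "length zs = p"
    using ys by (cases ys) auto
  obtain w where w: "commutator grp a y = (w, \<lambda>x. 1, 0)" "(w, \<lambda>x. 1, 0) \<in> carrier grp"
    by (rule twist_subgroup_commutator[OF f a y(2)])
  have "periodic w" using w(2) by (simp add: grp_simps residues_def)
  then have "iterated_commutator grp (w, \<lambda>x. 1, 0) zs = \<one>\<^bsub>grp\<^esub>"
    by (intro twist_subgroup_kills_translations[OF f w(2) _ y(3,4)] twisted_difference_unipotent f c)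
  then show "iterated_commutator grp a ys = \<one>\<^bsub>grp\<^esub>" by (simp add: y(1) w(1))
qed

lemma nilpotent_generate_gen:
  assumes y: "(v, f, c) \<in> carrier grp" and c: "c \<noteq> 0"
  shows "nilpotent_on grp (generate grp {gen, (v, f, c)})"
proof -
  have f: "f \<in> signs" and cp: "\<not> int p dvd c"
    using y c by (auto simp: grp_simps dest: zdvd_imp_le)
  have "\<exists>j. \<forall>u. periodic u \<longrightarrow> twist (\<lambda>x. 1) 0 u = (twist f c ^^ j) u"
    by (rule exI[of _ 0]) (simp add: twist_def)
  then have "gen \<in> twist_subgroup f c"
    using gen_in by (simp add: twist_subgroup_def gen_def)
  moreover have "\<exists>j. \<forall>u. periodic u \<longrightarrow> twist f c u = (twist f c ^^ j) u"
    by (rule exI[of _ 1]) simp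
  then have "(v, f, c) \<in> twist_subgroup f c"
    using y by (simp add: twist_subgroup_def)
  ultimately have "generate grp {gen, (v, f, c)} \<subseteq> twist_subgroup f c"
    by (intro generate_subgroup_incl twist_subgroup_is_subgroup f cp) simp
  then show ?thesis
    using nilpotent_twist_subgroup[OF f cp] nilpotent_on_mono by blast
qed

text \<open>Only elements without shift can fail, and these are a \<open>p\<close>-th part of the group.\<close>

lemma card_non_nilpotent:
  "card {y \<in> carrier grp. \<not> nilpotent_on grp (generate grp {gen, y})} * p \<le> card (carrier grp)"
proof -
  have "{y \<in> carrier grp. \<not> nilpotent_on grp (generate grp {gen, y})} \<subseteq> residues \<times> signs \<times> {0}"
  proof
    fix y assume y: "y \<in> {y \<in> carrier grp. \<not> nilpotent_on grp (generate grp {gen, y})}"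
    obtain v f c where e: "y = (v, f, c)" by (metis prod_cases3)
    show "y \<in> residues \<times> signs \<times> {0}"
      using y nilpotent_generate_gen[of v f c] by (auto simp: e grp_simps(1))
  qed
  then have "card {y \<in> carrier grp. \<not> nilpotent_on grp (generate grp {gen, y})} \<le> card (residues \<times> signs \<times> {0::int})"
    by (intro card_mono) (auto simp: finite_residues finite_signs)
  then show ?thesis
    by (simp add: grp_simps card_cartesian_product)
qed

end

lemma (in group_hom) nilpotent_on_img:
  assumes "S \<subseteq> carrier G" "nilpotent_on G S"
  shows "nilpotent_on H (h ` S)"
proof -
  obtain n where n: "\<And>x ys. x \<in> S \<Longrightarrow> ys \<in> lists S \<Longrightarrow> length ys = n \<Longrightarrow> iterated_commutator G x ys = \<one>"
    using assms(2) unfolding nilpotent_on_def by blast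
  show ?thesis
    unfolding nilpotent_on_def lists_image
  proof (intro exI[of _ n] ballI impI)
    fix a bs assume "a \<in> h ` S" "bs \<in> map h ` lists S" and len: "length bs = n"
    then obtain x ys where x: "a = h x" "x \<in> S" "bs = map h ys" "ys \<in> lists S" by blast
    have "x \<in> carrier G" "ys \<in> lists (carrier G)"
      using x assms(1) lists_mono[OF assms(1)] by blast+
    then show "iterated_commutator H a bs = \<one>\<^bsub>H\<^esub>"
      using hom_iterated_commutator[of x ys] n[of x ys] x len by simp
  qed
qed

text \<open>The group of signed shifts for a prime \<open>p > max 2 N\<close>, transported to natural numbers along an
injection. That \<open>p\<close> exceeds \<open>N\<close> serves both the orders and the proportion.\<close>

lemma exists_finite_factor:
  fixes N :: nat
  shows "\<exists>(\<Gamma> :: nat monoid) \<gamma>. group \<Gamma> \<and> finite (carrier \<Gamma>) \<and> \<gamma> \<in> carrier \<Gamma> \<and>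
    (derived \<Gamma> ^^ 3) (carrier \<Gamma>) = {\<one>\<^bsub>\<Gamma>\<^esub>} \<and>
    (\<forall>n. 0 < n \<longrightarrow> n \<le> N \<longrightarrow> \<gamma> [^]\<^bsub>\<Gamma>\<^esub> n \<notin> finite_hypercenter \<Gamma>) \<and>
    card {y \<in> carrier \<Gamma>. \<not> nilpotent_on \<Gamma> (generate \<Gamma> {\<gamma>, y})} * N \<le> card (carrier \<Gamma>)"
proof -
  obtain p where p: "prime p" "max 2 N < p" using bigger_prime by blast
  interpret signed_shifts p by unfold_locales (use p in auto)
  obtain \<phi> :: "signed_affine \<Rightarrow> nat" where \<phi>: "inj_on \<phi> (carrier grp)"
    using finite_imp_inj_to_nat_seg[OF finite_grp] by blast
  define \<Gamma> where "\<Gamma> = image_group \<phi> grp"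
  have carr: "carrier \<Gamma> = \<phi> ` carrier grp" and one: "\<one>\<^bsub>\<Gamma>\<^esub> = \<phi> \<one>\<^bsub>grp\<^esub>"
    by (simp_all add: \<Gamma>_def image_group_def)
  have hom: "\<phi> \<in> hom grp \<Gamma>"
    using \<phi> by (auto simp: hom_def \<Gamma>_def image_group_def)
  have "\<Gamma>\<lparr>carrier := \<phi> ` carrier grp, one := \<phi> \<one>\<^bsub>grp\<^esub>\<rparr> = \<Gamma>"
    by (simp add: \<Gamma>_def image_group_def)
  then have "group \<Gamma>" using hom_imp_img_group[OF hom] by simp
  then interpret \<Gamma>: group \<Gamma> .
  interpret \<phi>: group_hom grp \<Gamma> \<phi> by unfold_locales (rule hom)
  have eq_one: "\<phi> z = \<one>\<^bsub>\<Gamma>\<^esub> \<longleftrightarrow> z = \<one>\<^bsub>grp\<^esub>" if "z \<in> carrier grp" for z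
    unfolding one by (rule inj_on_eq_iff[OF \<phi> that one_closed])
  have hyper: "\<phi> x \<in> finite_hypercenter \<Gamma> \<longleftrightarrow> x \<in> finite_hypercenter grp" if x: "x \<in> carrier grp" for x
    using x unfolding finite_hypercenter_def UN_iff \<phi>.upper_central_surj_iff[OF carr[symmetric] x]
    by (simp add: upper_central_iff eq_one iterated_commutator_closed cong: imp_cong)
  have "\<phi> gen [^]\<^bsub>\<Gamma>\<^esub> n \<notin> finite_hypercenter \<Gamma>" if "0 < n" "n \<le> N" for n
    using hyper[OF nat_pow_closed[OF gen_in]] gen_pow_not_hypercentral[of n] that p gen_in
    by (simp add: \<phi>.hom_nat_pow)
  moreover have "(derived \<Gamma> ^^ 3) (carrier \<Gamma>) = {\<one>\<^bsub>\<Gamma>\<^esub>}"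
    using \<phi>.exp_of_derived_img[OF subset_refl, of 3] derived_grp by (simp add: carr)
  moreover have "card {y \<in> carrier \<Gamma>. \<not> nilpotent_on \<Gamma> (generate \<Gamma> {\<phi> gen, y})} * N \<le> card (carrier \<Gamma>)"
  proof -
    let ?B = "{y \<in> carrier grp. \<not> nilpotent_on grp (generate grp {gen, y})}"
    have "nilpotent_on \<Gamma> (generate \<Gamma> {\<phi> gen, \<phi> y})"
      if y: "y \<in> carrier grp" and n: "nilpotent_on grp (generate grp {gen, y})" for y
    proof -
      have sub: "{gen, y} \<subseteq> carrier grp" using y gen_in by blast
      have "generate \<Gamma> {\<phi> gen, \<phi> y} = \<phi> ` generate grp {gen, y}"
        using \<phi>.generate_img[OF sub] by (simp only: image_insert image_empty)
      then show ?thesis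
        using \<phi>.nilpotent_on_img[OF generate_incl[OF sub] n] by (simp only:)
    qed
    then have "{y \<in> carrier \<Gamma>. \<not> nilpotent_on \<Gamma> (generate \<Gamma> {\<phi> gen, y})} \<subseteq> \<phi> ` ?B"
      by (auto simp: carr)
    moreover have fin: "finite ?B" by (rule finite_subset[OF _ finite_grp]) blast
    ultimately have "card {y \<in> carrier \<Gamma>. \<not> nilpotent_on \<Gamma> (generate \<Gamma> {\<phi> gen, y})} \<le> card ?B"
      using order.trans[OF card_mono[OF finite_imageI[OF fin]] card_image_le[OF fin]] by blast
    then have "card {y \<in> carrier \<Gamma>. \<not> nilpotent_on \<Gamma> (generate \<Gamma> {\<phi> gen, y})} * N \<le> card ?B * p"
      using p by (intro mult_le_mono) auto
    also have "\<dots> \<le> card (carrier \<Gamma>)"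
      using card_non_nilpotent by (simp add: carr card_image[OF \<phi>])
    finally show ?thesis .
  qed
  ultimately show ?thesis
    using \<open>group \<Gamma>\<close> finite_grp gen_in by (intro exI[of _ \<Gamma>] exI[of _ "\<phi> gen"]) (auto simp: carr)
qed

section \<open>The profinite group\<close>

theorem theorem11:
  fixes \<epsilon> :: real
  assumes "\<epsilon> > 0"
  shows "\<exists>(G :: (nat \<Rightarrow> nat) monoid) T \<mu> g.
    profinite_group G T \<and> solvable G \<and>
    normalized_haar_measure G T \<mu> \<and>
    g \<in> carrier G \<and>
    measure \<mu> (pronilpotentizer G T g) > 1 - \<epsilon> \<and>
    (\<forall>n::nat. n > 0 \<longrightarrow> g [^]\<^bsub>G\<^esub> n \<notin> hypercenter G T) \<and>
    \<not> (\<exists>H. subgroup H G \<and> openin T H \<and>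
          g \<in> hypercenter (G \<lparr>carrier := H\<rparr>) (subtopology T H))"
proof -
  define d where "d i = (\<epsilon> / 4) * (1 / 2) ^ i" for i :: nat
  have d_pos: "0 < d i" for i using assms by (simp add: d_def)
  have sm: "summable d" unfolding d_def by (intro summable_mult summable_geometric) simp
  have "suminf d = \<epsilon> / 4 * (1 / (1 - 1 / 2))"
    unfolding d_def by (subst suminf_mult) (auto intro: summable_geometric simp: suminf_geometric)
  then have sum_d: "suminf d < \<epsilon>" using assms by simp
  \<comment> \<open>The part \<open>i \<le> N i\<close> makes the orders of the \<open>\<gamma> i\<close> modulo the hypercenters unbounded, the other part bounds the proportions.\<close>
  define N where "N i = max i (nat \<lceil>1 / d i\<rceil>)" for i :: nat
  define good where "good i \<Gamma> \<gamma> \<longleftrightarrow> group \<Gamma> \<and> finite (carrier \<Gamma>) \<and> \<gamma> \<in> carrier \<Gamma> \<and>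
      (derived \<Gamma> ^^ 3) (carrier \<Gamma>) = {\<one>\<^bsub>\<Gamma>\<^esub>} \<and>
      (\<forall>n. 0 < n \<longrightarrow> n \<le> N i \<longrightarrow> \<gamma> [^]\<^bsub>\<Gamma>\<^esub> n \<notin> finite_hypercenter \<Gamma>) \<and>
      card {y \<in> carrier \<Gamma>. \<not> nilpotent_on \<Gamma> (generate \<Gamma> {\<gamma>, y})} * N i \<le> card (carrier \<Gamma>)"
    for i and \<Gamma> :: "nat monoid" and \<gamma>
  have "\<forall>i. \<exists>\<Gamma> \<gamma>. good i \<Gamma> \<gamma>"
    unfolding good_def using exists_finite_factor by blast
  then obtain \<Gamma> \<gamma> where good: "\<And>i. good i (\<Gamma> i) (\<gamma> i)" by metis
  have fam: "\<And>i. group (\<Gamma> i)" "\<And>i. finite (carrier (\<Gamma> i))" "\<And>i. \<gamma> i \<in> carrier (\<Gamma> i)"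
    and der: "\<And>i. (derived (\<Gamma> i) ^^ 3) (carrier (\<Gamma> i)) = {\<one>\<^bsub>\<Gamma> i\<^esub>}"
    and hyp: "\<And>i n. 0 < n \<Longrightarrow> n \<le> N i \<Longrightarrow> \<gamma> i [^]\<^bsub>\<Gamma> i\<^esub> n \<notin> finite_hypercenter (\<Gamma> i)"
    and bad: "\<And>i. card {y \<in> carrier (\<Gamma> i). \<not> nilpotent_on (\<Gamma> i) (generate (\<Gamma> i) {\<gamma> i, y})} * N i
        \<le> card (carrier (\<Gamma> i))"
    using good unfolding good_def by blast+
  interpret finite_group_family \<Gamma> by (rule finite_group_family.intro[OF fam(1,2)])
  have \<gamma>: "\<gamma> \<in> carrier prod_grp" using fam(3) by (simp add: carrier_prod_grp)
  have no_open: "\<gamma> [^]\<^bsub>prod_grp\<^esub> n \<notin> hypercenter (prod_grp\<lparr>carrier := H\<rparr>) (subtopology prod_top H)"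
    if n: "0 < n" and H: "subgroup H prod_grp" "openin prod_top H" for n :: nat and H
  proof
    assume "\<gamma> [^]\<^bsub>prod_grp\<^esub> n \<in> hypercenter (prod_grp\<lparr>carrier := H\<rparr>) (subtopology prod_top H)"
    then obtain m where m: "\<And>i. m \<le> i \<Longrightarrow> (\<gamma> [^]\<^bsub>prod_grp\<^esub> n) i \<in> finite_hypercenter (\<Gamma> i)"
      using hypercenter_open_subgroup[OF H] by blast
    have "\<gamma> (max m n) [^]\<^bsub>\<Gamma> (max m n)\<^esub> n \<in> finite_hypercenter (\<Gamma> (max m n))"
      using m[of "max m n"] proj.hom_nat_pow[OF \<gamma>, of n "max m n"] by simp
    moreover have "n \<le> N (max m n)" by (simp add: N_def)
    ultimately show False using hyp[OF n] by blast
  qed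
  have fraction: "real (card {y \<in> carrier (\<Gamma> i). \<not> nilpotent_on (\<Gamma> i) (generate (\<Gamma> i) {\<gamma> i, y})})
      / real (card (carrier (\<Gamma> i))) \<le> d i" (is "real ?b / real ?c \<le> _") for i
  proof -
    have c: "0 < ?c" using carrier_nonempty finite_factor by (simp add: card_gt_0_iff)
    have "1 / d i \<le> real (N i)" unfolding N_def by linarith
    then have "1 \<le> real (N i) * d i" using d_pos[of i] by (simp add: field_simps)
    then have "real ?b \<le> real ?b * (real (N i) * d i)"
      using mult_left_mono[of 1 "real (N i) * d i" "real ?b"] by simp
    also have "\<dots> = real (?b * N i) * d i" by simp
    also have "\<dots> \<le> real ?c * d i"
      using bad[of i] d_pos[of i] by (intro mult_right_mono) (simp_all only: of_nat_le_iff less_imp_le)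
    finally show ?thesis using c by (simp add: field_simps)
  qed
  have "1 - suminf d \<le> measure haar (pronilpotentizer prod_grp prod_top \<gamma>)"
    unfolding pronilpotentizer_eq[OF \<gamma>]
    by (rule measure_haar_box[OF sm fraction])
  then have big: "1 - \<epsilon> < measure haar (pronilpotentizer prod_grp prod_top \<gamma>)"
    using sum_d by linarith
  have top: "subgroup (carrier prod_grp) prod_grp" "openin prod_top (carrier prod_grp)"
    using G.subgroup_self openin_topspace[of prod_top] by simp_all
  \<comment> \<open>The whole group is an open subgroup of itself, so the infinite order is a case of the statement on open subgroups.\<close>
  have whole: "prod_grp\<lparr>carrier := carrier prod_grp\<rparr> = prod_grp"
    "subtopology prod_top (carrier prod_grp) = prod_top"
    using subtopology_topspace[of prod_top] by simp_all
  have inf_order: "\<gamma> [^]\<^bsub>prod_grp\<^esub> n \<notin> hypercenter prod_grp prod_top" if "0 < n" for n :: nat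
    using no_open[OF that top] by (simp only: whole not_False_eq_True)
  have "\<gamma> [^]\<^bsub>prod_grp\<^esub> Suc 0 = \<gamma>"
    using G.l_one[OF \<gamma>] by (simp del: mult_prod_grp one_prod_grp)
  then have "\<not> (\<exists>H. subgroup H prod_grp \<and> openin prod_top H \<and>
      \<gamma> \<in> hypercenter (prod_grp\<lparr>carrier := H\<rparr>) (subtopology prod_top H))"
    using no_open[of "Suc 0"] by auto
  then show ?thesis
    using profinite solvable_prod_grp[OF der] normalized_haar \<gamma> big inf_order by blast
qed

end
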